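(* Let $A\in\mathcal P([n])$ and $F_0\in L(\Gamma(A))$. (1) For $A'\in\mathcal P(A)$, the solutions to the problem $$\text{Find } F\in L(\Gamma(A))\text{ such that } M_{A'}F=M_{A'}F_0$$ are all of the form $$\phi_A\sum_{B\in\bar{\mathcal P}(A')}\Psi_BF_0+\phi_A\mathbf X,\qquad \mathbf X\in\mathbb H\big(\bar{\mathcal P}(A)\setminus\bar{\mathcal P}(A')\big).$$ In particular the space of solutions has dimension $\dim\mathbb H(\bar{\mathcal P}(A)\setminus\bar{\mathcal P}(A'))=|A|!-|A'|!$. (2) More generally, for $\mathcal S\subset\mathcal P(A)$, put $\bar{\mathcal P}(\mathcal S)=\bigcup_{A'\in\mathcal S}\bar{\mathcal P}(A')$. The solutions to the problem $$\text{Find } F\in L(\Gamma(A))\text{ such that } M_{A'}F=M_{A'}F_0\text{ for all }A'\in\mathcal S$$ are all of the form $$\phi_A\sum_{B\in\bar{\mathcal P}(\mathcal S)}\Psi_BF_0+\phi_A\mathbf X,\qquad \mathbf X\in\mathbb H\big(\bar{\mathcal P}(A)\setminus\bar{\mathcal P}(\mathcal S)\big).$$ In particular the space of solutions has dimension $\dim\mathbb H(\bar{\mathcal P}(A)\setminus\bar{\mathcal P}(\mathcal S))=|A|!-\sum_{A'\in\mathcal S}d_{|A'|}$.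
   Context: Let $n\ge 1$ and $[n]=\{1,\dots,n\}$. For a finite set $E$: $\mathcal P(E)=\{A\subset E: |A|\ge 2\}$, $\bar{\mathcal P}(E)=\mathcal P(E)\cup\{\emptyset\}$, $L(E)$ is the space of functions $E\to\mathbb R$, $\delta_x$ is the Dirac function at $x$, $\mathbf 1_S$ the indicator of $S$. $d_k$ is the number of derangements (fixed-point free permutations) of a $k$-element set, $d_0=1$. An injective word on $[n]$ is a finite sequence $\pi=\pi_1\cdots\pi_k$ of distinct elements of $[n]$; its content is $c(\pi)=\{\pi_1,\dots,\pi_k\}$ and its length $|\pi|=k$. The empty word is $\bar 0$, with content $\emptyset$. $\Gamma(A)$ is the set of injective words with content $A$ (so $\Gamma(\emptyset)=\{\bar 0\}$), $\Gamma_n=\bigsqcup_{A\in\mathcal P([n])}\Gamma(A)$, $\bar\Gamma_n=\Gamma_n\cup\{\bar 0\}$. Each $L(\Gamma(A))$ is embedded in $L(\bar\Gamma_n)$ by extension by zero, so $L(\bar\Gamma_n)=\bigoplus_{A\in\bar{\mathcal P}([n])}L(\Gamma(A))$. $\pi\subset\sigma$ means that $\pi$ is a (not necessarily contiguous) subword of $\sigma$; $\pi\sqsubset\sigma$ means that $\pi$ is a contiguous subword of $\sigma$. Marginal operators: for $A\in\mathcal P([n])$, $M_A:L(\bar\Gamma_n)\to L(\Gamma(A))$ is $M_AF(\pi)=\sum_{\sigma\in\Gamma_n,\,\pi\subset\sigma}F(\sigma)$; and $M_\emptyset F=\big(\sum_{\pi\in\bar\Gamma_n}F(\pi)\big)\delta_{\bar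 0}$. By convention $M_A=M_\emptyset$ if $|A|=1$. Spaces: $H_\emptyset=L(\Gamma(\emptyset))=\mathbb R\delta_{\bar 0}$, and for $B\in\mathcal P([n])$, $H_B=\{F\in L(\Gamma(B)): M_{B'}F=0\text{ for all }B'\subsetneq B\}$. For a collection $\mathcal T\subset\bar{\mathcal P}([n])$, $\mathbb H(\mathcal T)=\bigoplus_{B\in\mathcal T}H_B$, and $\mathbb H_n=\mathbb H(\bar{\mathcal P}([n]))$. Synthesis operators: for $A\in\bar{\mathcal P}([n])$, $\phi_A:L(\bar\Gamma_n)\to L(\Gamma(A))$ is the linear map with $\phi_A\delta_{\bar 0}=\frac1{|A|!}\mathbf 1_{\Gamma(A)}$ and, for $\pi\ne\bar 0$, $\phi_A\delta_\pi=\frac1{(|A|-|\pi|+1)!}\mathbf 1_{\{\sigma\in\Gamma(A):\pi\sqsubset\sigma\}}$ if $c(\pi)\subset A$, and $\phi_A\delta_\pi=0$ otherwise. For $\mathbf X=(X_B)_B\in\mathbb H_n$, $\phi_A\mathbf X=\sum_{B}\phi_AX_B$. Wavelet transform: for every $A\in\bar{\mathcal P}([n])$ one has $L(\Gamma(A))=\bigoplus_{B\in\bar{\mathcal P}(A)}\phi_A(H_B)$ with $\phi_A$ injective on each $H_B$, $B\in\bar{\mathcal P}(A)$. Hence each $F\in L(\Gamma(A))$ can be written uniquely as $F=\sum_{B\in\bar{\mathcal P}(A)}\phi_A X_B$ with $X_B\in H_B$; one sets $\Psi_BF=X_B$ for $B\in\bar{\mathcal P}(A)$ and $\Psi_BF=0$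 for $B\not\subset A$. This is extended linearly to $\Psi_B:L(\bar\Gamma_n)\to H_B$.
   Formalization: In the last formula of (2) the sum of d_{|B|} runs over B in P̄(S) instead of over A' in S; as printed it fails for every nonempty S, e.g. A={1,2}, S={A} gives dimension 0, not 2!−d_2=1. *)

theory Defs
  imports
    Complex_Main
    "HOL-Library.Function_Algebras"
    "HOL-Library.Indicator_Function"
    "HOL-Library.Sublist"
    "HOL-Combinatorics.Permutations"
begin

text \<open>Real-valued functions form a real vector space under the pointwise operations
  (addition is the one of \<^theory>\<open>HOL-Library.Function_Algebras\<close>); this makes the library
  notions \<^const>\<open>span\<close>, \<^const>\<open>dim\<close>, ... available for spaces of functions.\<close>

instantiation "fun" :: (type, real_vector) real_vector
begin

definition scaleR_fun :: "real \<Rightarrow> ('a \<Rightarrow> 'b) \<Rightarrow> 'a \<Rightarrow> 'b"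
  where "scaleR_fun c f = (\<lambda>x. c *\<^sub>R f x)"

instance
  by standard
    (simp_all add: scaleR_fun_def fun_eq_iff scaleR_add_right scaleR_add_left)

end

text \<open>The dimension of an affine subspace, i.e. the dimension of its space of differences
  (\<open>aff_dim\<close> of HOL-Analysis is restricted to Euclidean spaces).\<close>

definition affine_dimension :: "'a::real_vector set \<Rightarrow> nat"
  where "affine_dimension S = dim {x - y | x y. x \<in> S \<and> y \<in> S}"

definition derangement_number :: "nat \<Rightarrow> nat"
  where "derangement_number k = card {p. p permutes {1..k} \<and> (\<forall>i\<in>{1..k}. p i \<noteq> i)}"


subsection \<open>Injective words\<close>

definition subsets2 :: "nat set \<Rightarrow> nat set set"  (\<open>\<P>\<close>)
  where "\<P> E = {A. A \<subseteq> E \<and> card A \<ge> 2}"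

definition subsets2_bar :: "nat set \<Rightarrow> nat set set"  (\<open>\<P>bar\<close>)
  where "\<P>bar E = \<P> E \<union> {{}}"

text \<open>An injective word is a distinct list: its content is \<^const>\<open>set\<close>, the subword relation
  is \<^const>\<open>subseq\<close> and the contiguous subword relation is \<^const>\<open>sublist\<close>.\<close>

type_synonym word = "nat list"

definition words_with_content :: "nat set \<Rightarrow> word set"  (\<open>\<Gamma>\<close>)
  where "\<Gamma> A = {\<pi>. distinct \<pi> \<and> set \<pi> = A}"

definition words :: "nat \<Rightarrow> word set"
  where "words n = (\<Union>A\<in>\<P> {1..n}. \<Gamma> A)"

definition words_bar :: "nat \<Rightarrow> word set"
  where "words_bar n = words n \<union> {[]}"

text \<open>The functions on a set of words, extended by zero to all words.\<close>

definition fun_space :: "word set \<Rightarrow> (word \<Rightarrow> real) set"  (\<open>\<L>\<close>)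
  where "\<L> S = {F. \<forall>\<pi>. \<pi> \<notin> S \<longrightarrow> F \<pi> = 0}"

definition restrict_zero :: "word set \<Rightarrow> (word \<Rightarrow> real) \<Rightarrow> word \<Rightarrow> real"
  where "restrict_zero S F = (\<lambda>\<pi>. if \<pi> \<in> S then F \<pi> else 0)"


subsection \<open>Marginal operators and the spaces \<open>H\<close>\<close>

text \<open>The first case covers the empty set and, by convention, singletons.\<close>

definition marginal :: "nat \<Rightarrow> nat set \<Rightarrow> (word \<Rightarrow> real) \<Rightarrow> word \<Rightarrow> real"
  where "marginal n A F =
    (if card A \<le> 1
     then (\<Sum>\<pi>\<in>words_bar n. F \<pi>) *\<^sub>R indicator {[]}
     else restrict_zero (\<Gamma> A) (\<lambda>\<pi>. \<Sum>\<sigma> | \<sigma> \<in> words n \<and> subseq \<pi> \<sigma>. F \<sigma>))"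

definition H_space :: "nat \<Rightarrow> nat set \<Rightarrow> (word \<Rightarrow> real) set"
  where "H_space n B =
    (if B = {} then \<L> (\<Gamma> {})
     else {F \<in> \<L> (\<Gamma> B). \<forall>B'. B' \<subset> B \<longrightarrow> marginal n B' F = 0})"

text \<open>A family \<open>(X\<^sub>B)\<^sub>B\<close> in the direct sum is identified with the function \<open>\<Sum>\<^sub>B X\<^sub>B\<close>;
  the summands lie in the spaces \<open>\<L> (\<Gamma> B)\<close>, whose supports are pairwise disjoint.\<close>

definition HH :: "nat \<Rightarrow> nat set set \<Rightarrow> (word \<Rightarrow> real) set"
  where "HH n T = {\<Sum>B\<in>T. X B | X. \<forall>B\<in>T. X B \<in> H_space n B}"


subsection \<open>Synthesis operators and the wavelet transform\<close>

definition synthesis_dirac :: "nat set \<Rightarrow> word \<Rightarrow> word \<Rightarrow> real"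
  where "synthesis_dirac A \<pi> =
    (if \<pi> = [] then (1 / fact (card A)) *\<^sub>R indicator (\<Gamma> A)
     else if set \<pi> \<subseteq> A
     then (1 / fact (card A - length \<pi> + 1)) *\<^sub>R indicator {\<sigma> \<in> \<Gamma> A. sublist \<pi> \<sigma>}
     else 0)"

definition synthesis :: "nat \<Rightarrow> nat set \<Rightarrow> (word \<Rightarrow> real) \<Rightarrow> word \<Rightarrow> real"
  where "synthesis n A F = (\<Sum>\<pi>\<in>words_bar n. F \<pi> *\<^sub>R synthesis_dirac A \<pi>)"

text \<open>For \<open>F \<in> \<L> (\<Gamma> A)\<close>, the family of the unique \<open>X\<^sub>B \<in> H\<^sub>B\<close>, for \<open>B \<in> \<P>bar A\<close>, with
  \<open>F = \<Sum>\<^sub>B \<phi>\<^sub>A X\<^sub>B\<close>; it is extended by zero to the other sets \<open>B\<close>.\<close>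

definition wavelet_family ::
    "nat \<Rightarrow> nat set \<Rightarrow> (word \<Rightarrow> real) \<Rightarrow> nat set \<Rightarrow> word \<Rightarrow> real"
  where "wavelet_family n A F =
    (THE X. (\<forall>B\<in>\<P>bar A. X B \<in> H_space n B) \<and> (\<forall>B. B \<notin> \<P>bar A \<longrightarrow> X B = 0)
       \<and> F = (\<Sum>B\<in>\<P>bar A. synthesis n A (X B)))"

text \<open>Linear extension along the decomposition of \<open>\<L> (words_bar n)\<close> as the direct sum of the
  \<open>\<L> (\<Gamma> A)\<close>.\<close>

definition wavelet :: "nat \<Rightarrow> nat set \<Rightarrow> (word \<Rightarrow> real) \<Rightarrow> word \<Rightarrow> real"
  where "wavelet n B F =
    (\<Sum>A\<in>\<P>bar {1..n}. wavelet_family n A (restrict_zero (\<Gamma> A) F) B)"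

definition subsets2_bar_Union :: "nat set set \<Rightarrow> nat set set"  (\<open>\<P>bar\<Union>\<close>)
  where "\<P>bar\<Union> \<S> = (\<Union>A'\<in>\<S>. \<P>bar A')"

end

theory Submission
  imports Defs "HOL-Combinatorics.Multiset_Permutations"
begin

text \<open>On functions supported on \<open>\<Gamma> A\<close> the marginal at \<open>A'\<close> is the push-forward along the map \<open>keep A'\<close>
that deletes the letters outside \<open>A'\<close>, because a word on \<open>A'\<close> is a subword of an injective word
exactly when it is what remains after the deletion (only singletons \<open>A'\<close> are exempt, by the convention
in \<open>marginal\<close>). Everything rests on one identity: for
\<open>X \<in> H_space n B\<close> with \<open>B \<subseteq> A\<close>, the push-forward to \<open>A' \<subseteq> A\<close> of \<open>synthesis n A X\<close> is
\<open>synthesis n A' X\<close>, which is zero unless \<open>B \<subseteq> A'\<close> (lemma \<open>pushforward_synthesis\<close>).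

To see this for nonempty \<open>B\<close>, contract the contiguous block \<open>\<pi>\<close> to a single letter \<open>b \<in> B\<close>: the words of \<open>\<Gamma> A\<close> that
contain \<open>\<pi>\<close> as a contiguous block are the words \<open>w\<close> on \<open>(A - B) \<union> {b}\<close> with \<open>b\<close> replaced by
\<open>\<pi>\<close>, so \<open>synthesis n A\<close> spreads the mass of \<open>\<pi>\<close> uniformly over all \<open>w\<close>. Deleting letters
acts on \<open>w\<close> and on \<open>\<pi>\<close> separately. If \<open>B \<subseteq> A'\<close>, then \<open>\<pi>\<close> is unchanged and the uniform distribution
on the words \<open>w\<close> goes to the uniform distribution, since the fibres of \<open>keep\<close> all have the same size.
If \<open>B\<close> is not contained in \<open>A'\<close>, then for each fixed \<open>w\<close> the sum over \<open>\<pi>\<close> only involves the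
push-forward of \<open>X\<close> to the proper subset \<open>A' \<inter> B\<close> of \<open>B\<close>, which vanishes by definition of
\<open>H_space\<close>.

The identity gives the wavelet decomposition. Marginals of \<open>\<Sum>\<^sub>B synthesis n A (X B)\<close> are triangular
in \<open>B\<close> with respect to inclusion, so the components \<open>X B\<close> are determined successively
(\<open>synthesis_sum_eq_0\<close>), and for the same reason every function on \<open>\<Gamma> A\<close> can be peeled off by subtracting
synthesised marginals in the order of increasing cardinality (\<open>synthesis_image_HH\<close>). Comparing
dimensions, \<open>(card A)!\<close> is the sum of the \<open>dim (H_space n B)\<close>; it is also the sum of the derangement
numbers of the sets \<open>B\<close>, as one sees by sorting the permutations of \<open>A\<close> by the set of points that they
move. Induction on \<open>B\<close> then shows that \<open>dim (H_space n B)\<close> is a derangement number.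

Finally, the marginal at \<open>A'\<close> of a function on \<open>\<Gamma> A\<close> is the synthesis on \<open>A'\<close> of its wavelet components
inside \<open>A'\<close>. By uniqueness of the decomposition on \<open>A'\<close>, two functions have the same marginal if and
only if these components agree (\<open>marginal_eq_iff_wavelet_family_eq\<close>). Prescribing the marginals on
\<open>\<S>\<close> therefore fixes the components in \<open>\<P>bar\<Union> \<S>\<close> and leaves all the others free.\<close>

section \<open>Deletion of letters\<close>

lemma words_with_content_eq_permutations_of_set: "\<Gamma> A = permutations_of_set A"
  by (auto simp: words_with_content_def permutations_of_set_def)

lemma finite_words_with_content [simp]: "finite (\<Gamma> A)"
  by (simp add: words_with_content_eq_permutations_of_set)

lemma card_words_with_content: "finite A \<Longrightarrow> card (\<Gamma> A) = fact (card A)"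
  by (simp add: words_with_content_eq_permutations_of_set)

lemma words_with_content_empty [simp]: "\<Gamma> {} = {[]}"
  by (auto simp: words_with_content_def)

text \<open>Marginals are push-forwards along this map.\<close>

abbreviation keep :: "nat set \<Rightarrow> word \<Rightarrow> word"
  where "keep B \<equiv> filter (\<lambda>x. x \<in> B)"

lemma keep_in_words: "B \<subseteq> A \<Longrightarrow> \<sigma> \<in> \<Gamma> A \<Longrightarrow> keep B \<sigma> \<in> \<Gamma> B"
  by (auto simp: words_with_content_def)

lemma keep_self: "\<sigma> \<in> \<Gamma> A \<Longrightarrow> A \<subseteq> B \<Longrightarrow> keep B \<sigma> = \<sigma>"
  by (auto simp: words_with_content_def filter_id_conv)

lemma subseq_distinct_imp_keep:
  "subseq \<pi> \<sigma> \<Longrightarrow> distinct \<sigma> \<Longrightarrow> keep (set \<pi>) \<sigma> = \<pi>"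
proof (induction rule: list_emb.induct)
  case (list_emb_Nil ys)
  then show ?case by simp
next
  case (list_emb_Cons xs ys y)
  have "set xs \<subseteq> set ys"
    using list_emb_set[OF list_emb_Cons.hyps] by blast
  then have "y \<notin> set xs"
    using list_emb_Cons.prems by auto
  with list_emb_Cons show ?case by simp
next
  case (list_emb_Cons2 x y xs ys)
  then have "keep (set (x # xs)) ys = keep (set xs) ys"
    by (intro filter_cong) auto
  with list_emb_Cons2 show ?case by simp
qed

lemma subseq_iff_keep:
  assumes "\<pi> \<in> \<Gamma> B" "\<sigma> \<in> \<Gamma> A"
  shows "subseq \<pi> \<sigma> \<longleftrightarrow> keep B \<sigma> = \<pi>"
proof
  show "subseq \<pi> \<sigma> \<Longrightarrow> keep B \<sigma> = \<pi>"
    using assms subseq_distinct_imp_keep[of \<pi> \<sigma>] by (auto simp: words_with_content_def)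
  show "keep B \<sigma> = \<pi> \<Longrightarrow> subseq \<pi> \<sigma>"
    using subseq_filter_left by metis
qed

text \<open>A permutation of \<open>B\<close> that relabels the letters of \<open>\<tau>\<close> so as to obtain \<open>\<tau>'\<close> commutes with \<open>keep B\<close>, and
so carries the fibre over \<open>\<tau>\<close> into the fibre over \<open>\<tau>'\<close>.\<close>

lemma card_keep_fibre_le:
  assumes A: "finite A" "B \<subseteq> A" and \<tau>: "\<tau> \<in> \<Gamma> B" "\<tau>' \<in> \<Gamma> B"
  shows "card {\<sigma> \<in> \<Gamma> A. keep B \<sigma> = \<tau>} \<le> card {\<sigma> \<in> \<Gamma> A. keep B \<sigma> = \<tau>'}"
proof -
  \<comment> \<open>relabel position by position, and fix the letters outside \<open>B\<close>\<close>
  define p where "p = (\<lambda>x. case map_of (zip \<tau> \<tau>') x of Some y \<Rightarrow> y | None \<Rightarrow> x)"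
  have [simp]: "distinct \<tau>" "distinct \<tau>'" "set \<tau> = B" "set \<tau>' = B"
    using \<tau> by (auto simp: words_with_content_def)
  have len: "length \<tau> = length \<tau>'"
    using distinct_card[of \<tau>] distinct_card[of \<tau>'] by simp
  have map: "map p \<tau> = \<tau>'"
    by (rule nth_equalityI) (use len in \<open>auto simp: p_def map_of_zip_nth\<close>)
  have out: "p x = x" if "x \<notin> B" for x
    using that len by (simp add: p_def split: option.split) (metis \<open>set \<tau> = B\<close> map_of_SomeD set_zip_leftD)
  have inj: "inj_on p B"
    using distinct_map[of p \<tau>] map by simp
  have im: "p ` B = B"
    using map by (metis \<open>set \<tau> = B\<close> \<open>set \<tau>' = B\<close> image_set)
  have mem: "p x \<in> B \<longleftrightarrow> x \<in> B" for x
    using out im by (metis image_eqI)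
  have injp: "inj p"
  proof (rule injI)
    fix x y assume eq: "p x = p y"
    then have "x \<in> B \<longleftrightarrow> y \<in> B" using mem by metis
    then show "x = y" using eq inj out by (cases "x \<in> B") (auto dest: inj_onD)
  qed
  have imA: "p ` A = A"
  proof -
    have "p ` (A - B) = A - B" using out by (force simp: image_iff)
    moreover have "A = B \<union> (A - B)" using A by auto
    ultimately show ?thesis using im by (metis image_Un)
  qed
  have "keep B (map p \<sigma>) = map p (keep B \<sigma>)" for \<sigma>
    using mem by (simp add: filter_map o_def)
  moreover have "inj_on p A"
    using injp by (rule inj_on_subset) simp
  ultimately have "map p ` {\<sigma> \<in> \<Gamma> A. keep B \<sigma> = \<tau>} \<subseteq> {\<sigma> \<in> \<Gamma> A. keep B \<sigma> = \<tau>'}"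
    using imA map by (auto simp: words_with_content_def distinct_map)
  then show ?thesis
    by (intro card_inj_on_le[of "map p"] inj_on_subset[OF inj_mapI[OF injp]]) auto
qed

text \<open>All fibres of \<open>keep B\<close> have the same size by symmetry, and they partition \<open>\<Gamma> A\<close>. In other words, deletion of
letters maps the uniform distribution on \<open>\<Gamma> A\<close> to the uniform distribution on \<open>\<Gamma> B\<close>.\<close>

lemma card_keep_fibre:
  assumes "finite A" "B \<subseteq> A" "\<tau> \<in> \<Gamma> B"
  shows "card {\<sigma> \<in> \<Gamma> A. keep B \<sigma> = \<tau>} * fact (card B) = fact (card A)"
proof -
  have "fact (card A) = (\<Sum>\<sigma>\<in>\<Gamma> A. 1::nat)"
    using assms by (simp add: card_words_with_content)
  also have "\<dots> = (\<Sum>\<tau>'\<in>\<Gamma> B. \<Sum>\<sigma> | \<sigma> \<in> \<Gamma> A \<and> keep B \<sigma> = \<tau>'. 1)"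
    by (rule sum.group[symmetric]) (use assms in \<open>auto intro: keep_in_words\<close>)
  also have "\<dots> = (\<Sum>\<tau>'\<in>\<Gamma> B. card {\<sigma> \<in> \<Gamma> A. keep B \<sigma> = \<tau>})"
    using assms by (intro sum.cong) (auto intro: antisym card_keep_fibre_le)
  finally show ?thesis
    using assms finite_subset[of B A] by (simp add: card_words_with_content)
qed

section \<open>Contiguous blocks\<close>

text \<open>Expansion of the letter \<open>b\<close> to the block \<open>\<pi>\<close>, the inverse of the contraction of a block to a letter.\<close>

definition substitute :: "nat \<Rightarrow> word \<Rightarrow> word \<Rightarrow> word"
  where "substitute b \<pi> w = concat (map (\<lambda>y. if y = b then \<pi> else [y]) w)"

lemma substitute_append [simp]:
  "substitute b \<pi> (u @ v) = substitute b \<pi> u @ substitute b \<pi> v"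
  by (simp add: substitute_def)

lemma substitute_Cons [simp]: "substitute b \<pi> (b # w) = \<pi> @ substitute b \<pi> w"
  by (simp add: substitute_def)

lemma substitute_other [simp]: "b \<notin> set w \<Longrightarrow> substitute b \<pi> w = w"
  unfolding substitute_def by (induction w) auto

text \<open>Letters may be deleted in the block and in the surrounding word independently. The placeholder \<open>b\<close> is kept
in the surrounding word even if it is deleted in the block, because it marks where the rest of the block goes.\<close>

lemma keep_substitute:
  assumes "b \<in> B" "set w \<inter> B \<subseteq> {b}"
  shows "keep A (substitute b \<pi> w) = substitute b (keep A \<pi>) (keep (insert b A) w)"
  using assms unfolding substitute_def by (induction w) auto

text \<open>A word \<open>u @ \<pi> @ v\<close> is the expansion of \<open>u @ [b] @ v\<close>. The contracted word is recovered from its expansion by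
deleting the letters of \<open>B\<close> other than \<open>b\<close>, which gives injectivity.\<close>

lemma bij_betw_substitute:
  assumes B: "b \<in> B" "B \<subseteq> A" and \<pi>: "\<pi> \<in> \<Gamma> B"
  shows "bij_betw (substitute b \<pi>) (\<Gamma> (insert b (A - B))) {\<sigma> \<in> \<Gamma> A. sublist \<pi> \<sigma>}"
proof (rule bij_betw_imageI)
  have "keep (insert b (A - B)) (substitute b \<pi> w) = w" if "w \<in> \<Gamma> (insert b (A - B))" for w
  proof -
    have "keep (insert b (A - B)) \<pi> = keep {b} \<pi>"
      using \<pi> by (intro filter_cong) (auto simp: words_with_content_def)
    also have "\<dots> = [b]"
      using subseq_distinct_imp_keep[of "[b]" \<pi>] \<pi> B
      by (simp add: words_with_content_def subseq_singleton_left)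
    finally have 1: "keep (insert b (A - B)) \<pi> = [b]" .
    have "keep (insert b (A - B)) (substitute b \<pi> w)
        = substitute b (keep (insert b (A - B)) \<pi>) (keep (insert b (insert b (A - B))) w)"
      using that B by (intro keep_substitute) (auto simp: words_with_content_def)
    also have "\<dots> = substitute b [b] w"
      unfolding 1 using keep_self[OF that subset_refl] by (simp only: insert_absorb2)
    also have "\<dots> = w"
      unfolding substitute_def by (induction w) auto
    finally show ?thesis .
  qed
  then show "inj_on (substitute b \<pi>) (\<Gamma> (insert b (A - B)))"
    by (rule inj_on_inverseI)
next
  show "substitute b \<pi> ` \<Gamma> (insert b (A - B)) = {\<sigma> \<in> \<Gamma> A. sublist \<pi> \<sigma>}" (is "?L = ?R")
  proof (intro equalityI subsetI)
    fix \<sigma> assume "\<sigma> \<in> ?L"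
    then obtain w where w: "distinct w" "set w = insert b (A - B)" "\<sigma> = substitute b \<pi> w"
      by (auto simp: words_with_content_def)
    then obtain u v where uv: "w = u @ [b] @ v"
      using split_list[of b w] by auto
    then have "\<sigma> = u @ \<pi> @ v" "set u \<union> set v = A - B" "distinct (u @ v)"
      using w B by (auto simp: insert_eq_iff)
    then show "\<sigma> \<in> ?R"
      using \<pi> B by (auto simp: words_with_content_def)
  next
    fix \<sigma> assume "\<sigma> \<in> ?R"
    then obtain u v where \<sigma>: "\<sigma> = u @ \<pi> @ v" "\<sigma> \<in> \<Gamma> A"
      by (auto simp: sublist_def)
    then have uv: "b \<notin> set u" "b \<notin> set v" "u @ [b] @ v \<in> \<Gamma> (insert b (A - B))"
      using \<pi> B by (auto simp: words_with_content_def)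
    then have "\<sigma> = substitute b \<pi> (u @ [b] @ v)"
      using \<sigma> by simp
    with uv show "\<sigma> \<in> ?L" by blast
  qed
qed

section \<open>Derangements\<close>

lemma card_derangements:
  assumes "finite E"
  shows "card {p. p permutes E \<and> (\<forall>i\<in>E. p i \<noteq> i)} = derangement_number (card E)"
proof -
  obtain f where f: "bij_betw f E {1..card E}"
    using ex_bij_betw_finite_nat[OF assms] ex_bij_betw_nat_finite_1[OF assms] bij_betw_inv by blast
  define g where "g = (\<lambda>\<pi> x. if x \<in> {1..card E} then f (\<pi> (inv_into E f x)) else x)"
  have g: "bij_betw g {\<pi>. \<pi> permutes E} {\<pi>. \<pi> permutes {1..card E}}"
    unfolding g_def by (rule bij_betw_permutations[OF f])
  have fix_iff: "(\<forall>i\<in>{1..card E}. g \<pi> i \<noteq> i) \<longleftrightarrow> (\<forall>i\<in>E. \<pi> i \<noteq> i)" if "\<pi> permutes E" for \<pi>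
  proof -
    have "g \<pi> (f i) = f i \<longleftrightarrow> \<pi> i = i" if "i \<in> E" for i
    proof -
      have "g \<pi> (f i) = f (\<pi> i)"
        using f that by (auto simp: g_def bij_betw_def)
      then show ?thesis
        using f that permutes_in_image[OF \<open>\<pi> permutes E\<close>] by (metis bij_betw_def inj_on_eq_iff)
    qed
    moreover have "{1..card E} = f ` E" using f by (simp add: bij_betw_def)
    ultimately show ?thesis by simp
  qed
  have "bij_betw g {\<pi> \<in> {\<pi>. \<pi> permutes E}. \<forall>i\<in>E. \<pi> i \<noteq> i}
          {\<pi> \<in> {\<pi>. \<pi> permutes {1..card E}}. \<forall>i\<in>{1..card E}. \<pi> i \<noteq> i}"
    using g fix_iff by (intro bij_betw_Collect) auto
  then show ?thesis
    unfolding derangement_number_def by (auto dest: bij_betw_same_card)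
qed

lemma finite_subsets2_bar [simp]: "finite A \<Longrightarrow> finite (\<P>bar A)"
  by (auto simp: subsets2_bar_def subsets2_def)

text \<open>The permutations of \<open>A\<close> that move exactly the points of \<open>B\<close> correspond to the derangements of \<open>B\<close>. No permutation
moves exactly one point, so the sets \<open>B\<close> that occur lie in \<open>\<P>bar A\<close>.\<close>

lemma sum_derangement_number:
  assumes "finite A"
  shows "(\<Sum>B\<in>\<P>bar A. derangement_number (card B)) = fact (card A)"
proof -
  define moved where "moved p = {x. p x \<noteq> x}" for p :: "nat \<Rightarrow> nat"
  have moved: "moved p \<in> \<P>bar A" if p: "p permutes A" for p
  proof -
    have sub: "moved p \<subseteq> A"
      using p by (auto simp: moved_def permutes_def)
    moreover have "card (moved p) \<ge> 2" if "moved p \<noteq> {}"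
    proof -
      from that obtain x where x: "p x \<noteq> x" by (auto simp: moved_def)
      then have "p (p x) \<noteq> p x" using permutes_inj[OF p] by (auto dest: injD)
      with x have "card {x, p x} = 2" "{x, p x} \<subseteq> moved p" by (auto simp: moved_def)
      then show ?thesis using sub assms by (metis card_mono finite_subset)
    qed
    ultimately show ?thesis by (auto simp: subsets2_bar_def subsets2_def)
  qed
  have fibre: "{p \<in> {p. p permutes A}. moved p = B} = {p. p permutes B \<and> (\<forall>i\<in>B. p i \<noteq> i)}"
    if "B \<subseteq> A" for B
  proof -
    have "p permutes B" if "p permutes A" "moved p = B" for p
      using that by (auto intro: permutes_superset simp: moved_def)
    then show ?thesis
      using that by (auto intro: permutes_subset simp: moved_def permutes_def)
  qed
  have "fact (card A) = (\<Sum>p | p permutes A. 1::nat)"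
    using card_permutations[OF refl assms] by simp
  also have "\<dots> = (\<Sum>B\<in>\<P>bar A. \<Sum>p | p \<in> {p. p permutes A} \<and> moved p = B. 1)"
    by (rule sum.group[symmetric]) (use assms moved in \<open>auto simp: finite_permutations\<close>)
  also have "\<dots> = (\<Sum>B\<in>\<P>bar A. derangement_number (card B))"
  proof (rule sum.cong)
    fix B assume "B \<in> \<P>bar A"
    then have "B \<subseteq> A" by (auto simp: subsets2_bar_def subsets2_def)
    then show "(\<Sum>p | p \<in> {p. p permutes A} \<and> moved p = B. 1) = derangement_number (card B)"
      using fibre[of B] card_derangements[of B] finite_subset[OF _ assms] by simp
  qed simp
  finally show ?thesis by simp
qed

section \<open>Spaces of functions on words\<close>

lemma subsets2_bar_subset: "B \<in> \<P>bar A \<Longrightarrow> B \<subseteq> A"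
  by (auto simp: subsets2_bar_def subsets2_def)

lemma subsets2_bar_mono: "A \<subseteq> A' \<Longrightarrow> \<P>bar A \<subseteq> \<P>bar A'"
  by (auto simp: subsets2_bar_def subsets2_def)

lemma subsets2_bar_trans: "B \<in> \<P>bar A \<Longrightarrow> A \<in> \<P>bar A' \<Longrightarrow> B \<in> \<P>bar A'"
  using subsets2_bar_mono subsets2_bar_subset by blast

lemma finite_of_subsets2_bar: "A \<in> \<P>bar {1..n} \<Longrightarrow> finite A"
  using finite_subset[OF subsets2_bar_subset] by blast

lemma self_in_subsets2_bar: "A \<in> \<P>bar E \<Longrightarrow> A \<in> \<P>bar A"
  by (auto simp: subsets2_bar_def subsets2_def)

lemma in_subsets2_bar_iff: "A \<in> \<P>bar E \<Longrightarrow> A \<in> \<P>bar A' \<longleftrightarrow> A \<subseteq> A'"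
  by (auto simp: subsets2_bar_def subsets2_def)

lemma sum_fun_apply: "(\<Sum>i\<in>I. f i) x = (\<Sum>i\<in>I. f i x)"
  by (induction I rule: infinite_finite_induct) auto

lemma scaleR_fun_apply [simp]: "(c *\<^sub>R f) x = c *\<^sub>R f x"
  by (simp add: scaleR_fun_def)

lemma subspace_fun_space: "subspace (\<L> S)"
  by (auto simp: subspace_def fun_space_def)

lemma fun_space_mono: "S \<subseteq> T \<Longrightarrow> \<L> S \<subseteq> \<L> T"
  by (auto simp: fun_space_def)

text \<open>This is used with \<open>h\<close> depending on \<open>F\<close>, to shrink sums over all words to sums over the words on which \<open>F\<close>
is supported.\<close>

lemma sum_eq_sum_over_support:
  "F \<in> \<L> S \<Longrightarrow> S \<subseteq> T \<Longrightarrow> finite T \<Longrightarrow> (\<And>\<pi>. F \<pi> = 0 \<Longrightarrow> h \<pi> = 0) \<Longrightarrow> sum h T = sum h S"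
  by (rule sum.mono_neutral_right) (auto simp: fun_space_def)

lemma finite_words_bar [simp]: "finite (words_bar n)"
proof -
  have "words_bar n \<subseteq> (\<Union>A\<in>Pow {1..n}. \<Gamma> A) \<union> {[]}"
    by (auto simp: words_bar_def words_def subsets2_def)
  then show ?thesis by (rule finite_subset) auto
qed

lemma words_with_content_subset_words_bar: "A \<in> \<P>bar {1..n} \<Longrightarrow> \<Gamma> A \<subseteq> words_bar n"
  by (auto simp: words_bar_def words_def subsets2_bar_def)

section \<open>Marginals as push-forwards\<close>

text \<open>For \<open>B\<close> empty or of at least two elements this is the marginal of a function on \<open>\<Gamma> A\<close>. Unlike \<open>marginal\<close> it does
not treat singletons specially, so that push-forwards compose without exceptions.\<close>

definition pushforward :: "nat set \<Rightarrow> nat set \<Rightarrow> (word \<Rightarrow> real) \<Rightarrow> word \<Rightarrow> real"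
  where "pushforward A B F = (\<lambda>\<tau>. \<Sum>\<sigma> | \<sigma> \<in> \<Gamma> A \<and> keep B \<sigma> = \<tau>. F \<sigma>)"

lemma pushforward_in_fun_space: "B \<subseteq> A \<Longrightarrow> pushforward A B F \<in> \<L> (\<Gamma> B)"
  unfolding pushforward_def fun_space_def using keep_in_words by (auto intro: sum.neutral)

lemma linear_pushforward: "linear (pushforward A B)"
  by (rule linearI) (auto simp: pushforward_def fun_eq_iff sum.distrib sum_distrib_left)

lemma pushforward_self: "F \<in> \<L> (\<Gamma> A) \<Longrightarrow> pushforward A A F = F"
proof (rule ext)
  fix \<tau> assume F: "F \<in> \<L> (\<Gamma> A)"
  have "{\<sigma>. \<sigma> \<in> \<Gamma> A \<and> keep A \<sigma> = \<tau>} = (if \<tau> \<in> \<Gamma> A then {\<tau>} else {})"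
    by (auto simp: keep_self)
  then show "pushforward A A F \<tau> = F \<tau>"
    using F by (auto simp: pushforward_def fun_space_def)
qed

lemma pushforward_pushforward:
  assumes "C \<subseteq> B" "B \<subseteq> A"
  shows "pushforward B C (pushforward A B F) = pushforward A C F"
proof (rule ext)
  fix \<rho>
  have keep: "keep C (keep B \<sigma>) = keep C \<sigma>" for \<sigma>
    unfolding filter_filter using assms(1) by (intro filter_cong) auto
  have "pushforward B C (pushforward A B F) \<rho> =
      (\<Sum>\<tau> | \<tau> \<in> \<Gamma> B \<and> keep C \<tau> = \<rho>.
         \<Sum>\<sigma> | \<sigma> \<in> {\<sigma> \<in> \<Gamma> A. keep C \<sigma> = \<rho>} \<and> keep B \<sigma> = \<tau>. F \<sigma>)"
    unfolding pushforward_def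
    by (intro sum.cong refl arg_cong2[where f = sum]) (auto simp: keep simp del: filter_filter)
  also have "\<dots> = (\<Sum>\<sigma> | \<sigma> \<in> \<Gamma> A \<and> keep C \<sigma> = \<rho>. F \<sigma>)"
    by (rule sum.group) (use assms keep_in_words in \<open>auto simp: keep simp del: filter_filter\<close>)
  finally show "pushforward B C (pushforward A B F) \<rho> = pushforward A C F \<rho>"
    by (simp add: pushforward_def)
qed

lemma pushforward_empty: "pushforward A {} F = (\<Sum>\<sigma>\<in>\<Gamma> A. F \<sigma>) *\<^sub>R indicator {[]}"
proof (rule ext)
  fix \<tau> :: word
  have "{\<sigma>. \<sigma> \<in> \<Gamma> A \<and> keep {} \<sigma> = \<tau>} = (if \<tau> = [] then \<Gamma> A else {})" by auto
  then show "pushforward A {} F \<tau> = ((\<Sum>\<sigma>\<in>\<Gamma> A. F \<sigma>) *\<^sub>R indicator {[]}) \<tau>"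
    by (auto simp: pushforward_def)
qed

text \<open>Both push-forwards only record the total mass. Hence the convention for singletons in \<open>marginal\<close> does not
change the conditions that define \<open>H_space\<close>.\<close>

lemma pushforward_singleton_eq_0:
  assumes "c \<in> A" "pushforward A {} F = 0"
  shows "pushforward A {c} F = 0"
proof (rule ext)
  fix \<tau>
  have tot: "(\<Sum>\<sigma>\<in>\<Gamma> A. F \<sigma>) = 0"
    using fun_cong[OF assms(2), of "[]"] by (simp add: pushforward_empty)
  have "keep {c} \<sigma> = [c]" if "\<sigma> \<in> \<Gamma> A" for \<sigma>
    using that assms(1) subseq_distinct_imp_keep[of "[c]" \<sigma>]
    by (simp add: words_with_content_def subseq_singleton_left)
  then have "{\<sigma>. \<sigma> \<in> \<Gamma> A \<and> keep {c} \<sigma> = \<tau>} = (if \<tau> = [c] then \<Gamma> A else {})"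
    by auto
  then show "pushforward A {c} F \<tau> = 0 \<tau>"
    using tot by (auto simp: pushforward_def)
qed

lemma marginal_eq_pushforward:
  assumes A: "A \<in> \<P>bar {1..n}" and B: "B \<in> \<P>bar A" and F: "F \<in> \<L> (\<Gamma> A)"
  shows "marginal n B F = pushforward A B F"
proof (cases "B = {}")
  case True
  have "(\<Sum>\<pi>\<in>words_bar n. F \<pi>) = (\<Sum>\<pi>\<in>\<Gamma> A. F \<pi>)"
    using words_with_content_subset_words_bar[OF A] by (intro sum_eq_sum_over_support[OF F]) auto
  then show ?thesis
    by (simp add: True marginal_def pushforward_empty)
next
  case False
  then have card: "card B \<ge> 2" and sub: "B \<subseteq> A"
    using B by (auto simp: subsets2_bar_def subsets2_def)
  have ne: "A \<noteq> {}" using False sub by auto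
  have *: "(\<Sum>\<sigma> | \<sigma> \<in> words n \<and> subseq \<pi> \<sigma>. F \<sigma>) = pushforward A B F \<pi>" if "\<pi> \<in> \<Gamma> B" for \<pi>
    unfolding pushforward_def
  proof (rule sum.mono_neutral_right)
    show "finite {\<sigma> \<in> words n. subseq \<pi> \<sigma>}"
      by (rule finite_subset[OF _ finite_words_bar[of n]]) (auto simp: words_bar_def)
    show "{\<sigma> \<in> \<Gamma> A. keep B \<sigma> = \<pi>} \<subseteq> {\<sigma> \<in> words n. subseq \<pi> \<sigma>}"
      using A ne by (auto simp: words_def subsets2_bar_def)
    show "\<forall>\<sigma>\<in>{\<sigma> \<in> words n. subseq \<pi> \<sigma>} - {\<sigma> \<in> \<Gamma> A. keep B \<sigma> = \<pi>}. F \<sigma> = 0"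
      using F subseq_iff_keep[OF that] by (auto simp: fun_space_def)
  qed
  then show ?thesis
    using card pushforward_in_fun_space[OF sub, of F]
    by (auto simp: marginal_def restrict_zero_def fun_space_def fun_eq_iff)
qed

text \<open>Singletons may be left out of the conditions, because there the marginal is by convention the one at the empty
set. The case \<open>B = {}\<close> fits the general description, as \<open>\<P>bar {} - {{}}\<close> is empty.\<close>

lemma H_space_eq:
  assumes B: "B \<in> \<P>bar {1..n}"
  shows "H_space n B = {F \<in> \<L> (\<Gamma> B). \<forall>C\<in>\<P>bar B - {B}. pushforward B C F = 0}"
proof (cases "B = {}")
  case True
  then show ?thesis by (auto simp: H_space_def subsets2_bar_def subsets2_def)
next
  case False
  have fin: "finite B" using B by (rule finite_of_subsets2_bar)
  have "(\<forall>C. C \<subset> B \<longrightarrow> marginal n C F = 0) \<longleftrightarrow> (\<forall>C\<in>\<P>bar B - {B}. pushforward B C F = 0)"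
    if F: "F \<in> \<L> (\<Gamma> B)" for F
  proof (intro iffI ballI allI impI)
    fix C assume L: "\<forall>C. C \<subset> B \<longrightarrow> marginal n C F = 0" and C: "C \<in> \<P>bar B - {B}"
    have "pushforward B C F = marginal n C F"
      using C marginal_eq_pushforward[OF B _ F] by simp
    moreover have "C \<subset> B"
      using C subsets2_bar_subset by blast
    ultimately show "pushforward B C F = 0"
      using L by simp
  next
    fix C assume R: "\<forall>C\<in>\<P>bar B - {B}. pushforward B C F = 0" and C: "C \<subset> B"
    show "marginal n C F = 0"
    proof (cases "card C \<ge> 2")
      case True
      then have "C \<in> \<P>bar B" using C by (auto simp: subsets2_bar_def subsets2_def)
      then show ?thesis using R C marginal_eq_pushforward[OF B _ F] by simp
    next
      case False
      have empty: "{} \<in> \<P>bar B" by (simp add: subsets2_bar_def)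
      have "marginal n C F = marginal n {} F"
        using False by (simp add: marginal_def)
      also have "\<dots> = 0"
        using R empty \<open>B \<noteq> {}\<close> marginal_eq_pushforward[OF B empty F] by simp
      finally show ?thesis .
    qed
  qed
  then show ?thesis using False by (auto simp: H_space_def)
qed

lemma H_space_subset: "B \<in> \<P>bar {1..n} \<Longrightarrow> H_space n B \<subseteq> \<L> (\<Gamma> B)"
  by (auto simp: H_space_eq)

lemma pushforward_H_space:
  assumes B: "B \<in> \<P>bar {1..n}" and X: "X \<in> H_space n B" and C: "C \<subset> B"
  shows "pushforward B C X = 0"
proof (cases "C \<in> \<P>bar B")
  case True
  then show ?thesis using X C by (auto simp: H_space_eq[OF B])
next
  case False
  have "finite C" using C finite_of_subsets2_bar[OF B] finite_subset by blast
  then have "card C = 1"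
    using False C by (cases "card C") (auto simp: subsets2_bar_def subsets2_def)
  then obtain c where c: "C = {c}" by (auto simp: card_1_singleton_iff)
  have "{} \<in> \<P>bar B - {B}" using C by (auto simp: subsets2_bar_def)
  then have "pushforward B {} X = 0" using X by (auto simp: H_space_eq[OF B])
  then show ?thesis using c C by (auto intro: pushforward_singleton_eq_0)
qed

lemma subspace_H_space: "B \<in> \<P>bar {1..n} \<Longrightarrow> subspace (H_space n B)"
  using subspace_fun_space[of "\<Gamma> B"]
  by (auto simp: H_space_eq subspace_def linear_add[OF linear_pushforward]
      linear_scale[OF linear_pushforward] linear_0[OF linear_pushforward])

section \<open>Marginals of synthesised functions\<close>

lemma linear_synthesis: "linear (synthesis n A)"
  by (rule linearI)
    (auto simp: synthesis_def fun_eq_iff sum_fun_apply sum.distrib sum_distrib_left algebra_simps)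

lemma synthesis_eq:
  assumes "B \<in> \<P>bar {1..n}" "X \<in> \<L> (\<Gamma> B)"
  shows "synthesis n A X = (\<Sum>\<pi>\<in>\<Gamma> B. X \<pi> *\<^sub>R synthesis_dirac A \<pi>)"
  unfolding synthesis_def using words_with_content_subset_words_bar[OF assms(1)]
  by (intro sum_eq_sum_over_support[OF assms(2)]) auto

lemma synthesis_in_fun_space: "synthesis n A X \<in> \<L> (\<Gamma> A)"
  by (auto simp: synthesis_def fun_space_def sum_fun_apply synthesis_dirac_def intro!: sum.neutral)

lemma synthesis_eq_0:
  assumes "B \<in> \<P>bar {1..n}" "X \<in> \<L> (\<Gamma> B)" "\<not> B \<subseteq> A"
  shows "synthesis n A X = 0"
  unfolding synthesis_eq[OF assms(1,2)]
  using assms(3) by (intro sum.neutral) (auto simp: words_with_content_def synthesis_dirac_def)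

text \<open>A block of full content is the whole word, and the normalising constant is \<open>1! = 1\<close> (or \<open>0! = 1\<close> for the empty
word).\<close>

lemma synthesis_self:
  assumes "B \<in> \<P>bar {1..n}" "X \<in> \<L> (\<Gamma> B)"
  shows "synthesis n B X = X"
proof -
  have dirac: "synthesis_dirac B \<pi> = indicator {\<pi>}" if \<pi>: "\<pi> \<in> \<Gamma> B" for \<pi>
  proof (cases "\<pi> = []")
    case True
    then have "B = {}" using \<pi> by (auto simp: words_with_content_def)
    then show ?thesis using True by (simp add: synthesis_dirac_def)
  next
    case False
    have len: "length \<pi> = card B" "set \<pi> = B"
      using \<pi> by (auto simp: words_with_content_def distinct_card)
    have "\<sigma> = \<pi>" if \<sigma>: "\<sigma> \<in> \<Gamma> B" "sublist \<pi> \<sigma>" for \<sigma>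
    proof -
      have "length \<sigma> = length \<pi>"
        using \<sigma> len distinct_card[of \<sigma>] by (auto simp: words_with_content_def)
      then show ?thesis using \<sigma>(2) by (auto simp: sublist_def)
    qed
    then have "{\<sigma> \<in> \<Gamma> B. sublist \<pi> \<sigma>} = {\<pi>}" using \<pi> by auto
    then show ?thesis using False len by (simp add: synthesis_dirac_def)
  qed
  show ?thesis
  proof (rule ext)
    fix \<sigma>
    have "synthesis n B X \<sigma> = (\<Sum>\<pi>\<in>\<Gamma> B. if \<pi> = \<sigma> then X \<pi> else 0)"
      unfolding synthesis_eq[OF assms] sum_fun_apply
      by (intro sum.cong) (auto simp: dirac indicator_def)
    also have "\<dots> = X \<sigma>"
      using assms(2) by (auto simp: fun_space_def)
    finally show "synthesis n B X \<sigma> = X \<sigma>" .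
  qed
qed

text \<open>Contraction of the block \<open>\<pi>\<close> to \<open>b\<close> turns the words over which \<open>synthesis_dirac A \<pi>\<close> is spread into arbitrary
words \<open>w\<close>, and the deletion map factors accordingly.\<close>

lemma pushforward_synthesis_dirac:
  assumes A: "finite A" and B: "b \<in> B" "B \<subseteq> A" and \<pi>: "\<pi> \<in> \<Gamma> B"
  shows "pushforward A A' (synthesis_dirac A \<pi>) \<tau> =
    card {w \<in> \<Gamma> (insert b (A - B)). substitute b (keep A' \<pi>) (keep (insert b A') w) = \<tau>}
      / fact (card A - card B + 1)"
proof -
  have \<pi>': "length \<pi> = card B" "\<pi> \<noteq> []" "set \<pi> = B"
    using \<pi> B by (auto simp: words_with_content_def distinct_card)
  have "pushforward A A' (synthesis_dirac A \<pi>) \<tau> =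
      (\<Sum>\<sigma> | \<sigma> \<in> \<Gamma> A \<and> keep A' \<sigma> = \<tau>.
        1 / fact (card A - card B + 1) * indicator {\<sigma> \<in> \<Gamma> A. sublist \<pi> \<sigma>} \<sigma>)"
    using \<pi>' B by (simp add: pushforward_def synthesis_dirac_def)
  also have "\<dots> = 1 / fact (card A - card B + 1) *
      card {\<sigma> \<in> {\<sigma> \<in> \<Gamma> A. sublist \<pi> \<sigma>}. keep A' \<sigma> = \<tau>}"
    unfolding sum_distrib_left[symmetric]
    by (simp add: indicator_def sum.If_cases) (auto intro!: disjI2 arg_cong[where f = card])
  also have "card {\<sigma> \<in> {\<sigma> \<in> \<Gamma> A. sublist \<pi> \<sigma>}. keep A' \<sigma> = \<tau>} =
      card {w \<in> \<Gamma> (insert b (A - B)). keep A' (substitute b \<pi> w) = \<tau>}"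
    by (rule bij_betw_same_card[symmetric], rule bij_betw_Collect[OF bij_betw_substitute])
      (use B \<pi> in \<open>auto\<close>)
  also have "{w \<in> \<Gamma> (insert b (A - B)). keep A' (substitute b \<pi> w) = \<tau>} =
      {w \<in> \<Gamma> (insert b (A - B)). substitute b (keep A' \<pi>) (keep (insert b A') w) = \<tau>}"
    using B by (intro Collect_cong conj_cong refl, subst keep_substitute[of b B])
      (auto simp: words_with_content_def)
  finally show ?thesis by simp
qed

text \<open>If the block survives the deletion, only the surrounding words are shortened, and the uniform distribution on them
is preserved by \<open>card_keep_fibre\<close>. The constants match because \<open>(A - B) \<union> {b}\<close> has \<open>card A - card B + 1\<close>
elements. The empty block needs a separate argument, because it has no letter \<open>b\<close> to which it could be
contracted.\<close>

lemma pushforward_synthesis_dirac_subset: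
  assumes A: "finite A" "A' \<subseteq> A" and B: "B \<subseteq> A'" and \<pi>: "\<pi> \<in> \<Gamma> B"
  shows "pushforward A A' (synthesis_dirac A \<pi>) = synthesis_dirac A' \<pi>"
proof (rule ext)
  fix \<tau>
  show "pushforward A A' (synthesis_dirac A \<pi>) \<tau> = synthesis_dirac A' \<pi> \<tau>"
  proof (cases "B = {}")
    case True
    then have [simp]: "\<pi> = []" using \<pi> by simp
    have "pushforward A A' (synthesis_dirac A \<pi>) \<tau>
        = card {\<sigma> \<in> \<Gamma> A. keep A' \<sigma> = \<tau>} / fact (card A)"
      by (simp add: pushforward_def synthesis_dirac_def)
    also have "\<dots> = indicator (\<Gamma> A') \<tau> / fact (card A')"
    proof (cases "\<tau> \<in> \<Gamma> A'")
      case True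
      then show ?thesis
        using arg_cong[OF card_keep_fibre[OF A True], of real] by (simp add: field_simps)
    next
      case False
      then have "{\<sigma> \<in> \<Gamma> A. keep A' \<sigma> = \<tau>} = {}" using A keep_in_words by blast
      then show ?thesis using False by simp
    qed
    finally show ?thesis by (simp add: synthesis_dirac_def)
  next
    case False
    then obtain b where b: "b \<in> B" by auto
    define E where "E = insert b (A - B)"
    define E' where "E' = insert b (A' - B)"
    have sub: "B \<subseteq> A" using A B by auto
    have fin: "finite A'" "finite B" "finite E"
      using A B sub by (auto simp: E_def intro: finite_subset)
    have card: "card E = card A - card B + 1" "card E' = card A' - card B + 1"
      unfolding E_def E'_def using b fin A(1) B sub by (auto simp: card_Diff_subset)
    have EE: "E' \<subseteq> E" using A by (auto simp: E_def E'_def)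
    have \<pi>': "length \<pi> = card B" "\<pi> \<noteq> []" "set \<pi> = B"
      using \<pi> b by (auto simp: words_with_content_def distinct_card)
    have bij: "bij_betw (substitute b \<pi>) (\<Gamma> E') {\<sigma> \<in> \<Gamma> A'. sublist \<pi> \<sigma>}"
      unfolding E'_def using b B \<pi> by (rule bij_betw_substitute)
    have "pushforward A A' (synthesis_dirac A \<pi>) \<tau>
        = card {w \<in> \<Gamma> E. substitute b (keep A' \<pi>) (keep (insert b A') w) = \<tau>} / fact (card E)"
      unfolding card(1) unfolding E_def
      by (rule pushforward_synthesis_dirac) (use A(1) b sub \<pi> in auto)
    also have "{w \<in> \<Gamma> E. substitute b (keep A' \<pi>) (keep (insert b A') w) = \<tau>}
        = {w \<in> \<Gamma> E. substitute b \<pi> (keep E' w) = \<tau>}"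
    proof (intro Collect_cong conj_cong refl)
      fix w assume "w \<in> \<Gamma> E"
      then have "keep (insert b A') w = keep E' w"
        by (intro filter_cong) (auto simp: words_with_content_def E_def E'_def)
      then show "(substitute b (keep A' \<pi>) (keep (insert b A') w) = \<tau>) =
          (substitute b \<pi> (keep E' w) = \<tau>)"
        using keep_self[OF \<pi> B] by simp
    qed
    also have "card \<dots> / fact (card E) = indicator {\<sigma> \<in> \<Gamma> A'. sublist \<pi> \<sigma>} \<tau> / fact (card E')"
    proof (cases "\<tau> \<in> {\<sigma> \<in> \<Gamma> A'. sublist \<pi> \<sigma>}")
      case True
      then obtain w' where w': "w' \<in> \<Gamma> E'" "\<tau> = substitute b \<pi> w'"
        using bij by (auto simp: bij_betw_def)
      have "substitute b \<pi> (keep E' w) = \<tau> \<longleftrightarrow> keep E' w = w'" if "w \<in> \<Gamma> E" for w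
        using w' keep_in_words[OF EE that] bij by (auto simp: bij_betw_def dest: inj_onD)
      then have "{w \<in> \<Gamma> E. substitute b \<pi> (keep E' w) = \<tau>} = {w \<in> \<Gamma> E. keep E' w = w'}"
        by auto
      then show ?thesis
        using True arg_cong[OF card_keep_fibre[OF fin(3) EE w'(1)], of real]
        by (simp add: field_simps)
    next
      case False
      have "substitute b \<pi> (keep E' w) \<noteq> \<tau>" if "w \<in> \<Gamma> E" for w
        using False bij keep_in_words[OF EE that] by (auto simp: bij_betw_def)
      then have "{w \<in> \<Gamma> E. substitute b \<pi> (keep E' w) = \<tau>} = {}" by auto
      then show ?thesis using False by simp
    qed
    finally show ?thesis using \<pi>' B by (simp add: synthesis_dirac_def card)
  qed
qed

text \<open>If the block loses a letter, the outcome depends on \<open>\<pi>\<close> only through \<open>keep (A' \<inter> B) \<pi>\<close>. For each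
surrounding word \<open>w\<close> the sum over \<open>\<pi>\<close> is then a combination of values of the push-forward of \<open>X\<close> to
\<open>A' \<inter> B\<close>, which is zero.\<close>

lemma pushforward_synthesis_eq_0:
  assumes A: "finite A" and B: "B \<in> \<P>bar {1..n}" "B \<subseteq> A" "\<not> B \<subseteq> A'" and X: "X \<in> H_space n B"
  shows "(\<Sum>\<pi>\<in>\<Gamma> B. X \<pi> *\<^sub>R pushforward A A' (synthesis_dirac A \<pi>)) = 0"
proof (rule ext)
  fix \<tau>
  obtain b where b: "b \<in> B" using B by auto
  define E where "E = insert b (A - B)"
  define g where "g w \<rho> = substitute b \<rho> (keep (insert b A') w)" for w \<rho>
  define C where "C = A' \<inter> B"
  have CB: "C \<subset> B" using B by (auto simp: C_def)
  have keepC: "keep A' \<pi> = keep C \<pi>" if "\<pi> \<in> \<Gamma> B" for \<pi>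
    using that by (intro filter_cong) (auto simp: words_with_content_def C_def)
  have vanish: "(\<Sum>\<pi>\<in>\<Gamma> B. X \<pi> * of_bool (g w (keep A' \<pi>) = \<tau>)) = 0" for w
  proof -
    have "(\<Sum>\<pi>\<in>\<Gamma> B. X \<pi> * of_bool (g w (keep A' \<pi>) = \<tau>))
        = (\<Sum>\<pi>\<in>\<Gamma> B. X \<pi> * of_bool (g w (keep C \<pi>) = \<tau>))"
      by (simp add: keepC)
    also have "\<dots> = (\<Sum>\<rho>\<in>\<Gamma> C. \<Sum>\<pi> | \<pi> \<in> \<Gamma> B \<and> keep C \<pi> = \<rho>. X \<pi> * of_bool (g w (keep C \<pi>) = \<tau>))"
      by (rule sum.group[symmetric]) (use CB keep_in_words in auto)
    also have "\<dots> = (\<Sum>\<rho>\<in>\<Gamma> C. pushforward B C X \<rho> * of_bool (g w \<rho> = \<tau>))"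
      by (auto simp: pushforward_def sum_distrib_right intro!: sum.cong)
    also have "\<dots> = 0"
      using pushforward_H_space[OF B(1) X CB] by simp
    finally show ?thesis .
  qed
  have "(\<Sum>\<pi>\<in>\<Gamma> B. X \<pi> *\<^sub>R pushforward A A' (synthesis_dirac A \<pi>)) \<tau> =
      (\<Sum>\<pi>\<in>\<Gamma> B. X \<pi> * (card {w \<in> \<Gamma> E. g w (keep A' \<pi>) = \<tau>} / fact (card A - card B + 1)))"
    unfolding sum_fun_apply scaleR_fun_apply real_scaleR_def E_def g_def
    by (intro sum.cong refl arg_cong2[where f = "(*)"] pushforward_synthesis_dirac)
      (use A B b in \<open>auto\<close>)
  also have "\<dots> = (\<Sum>\<pi>\<in>\<Gamma> B. \<Sum>w\<in>\<Gamma> E. X \<pi> * of_bool (g w (keep A' \<pi>) = \<tau>)) / fact (card A - card B + 1)"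
    unfolding sum_divide_distrib
    by (intro sum.cong refl) (simp add: sum_distrib_left[symmetric] sum_divide_distrib[symmetric]
      of_bool_def sum.If_cases Int_def)
  also have "\<dots> = 0"
    by (subst sum.swap) (simp add: vanish)
  finally show "(\<Sum>\<pi>\<in>\<Gamma> B. X \<pi> *\<^sub>R pushforward A A' (synthesis_dirac A \<pi>)) \<tau> = 0 \<tau>"
    by simp
qed

text \<open>The push-forwards of a synthesised function to smaller sets are synthesised from the same component, with the ambient set replaced. If \<open>B\<close> is not contained in
\<open>A'\<close>, both sides vanish, the right-hand side by definition and the left-hand side by
\<open>pushforward_synthesis_eq_0\<close>.\<close>

lemma pushforward_synthesis:
  assumes A: "A \<in> \<P>bar {1..n}" "A' \<subseteq> A" and B: "B \<in> \<P>bar A" and X: "X \<in> H_space n B"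
  shows "pushforward A A' (synthesis n A X) = synthesis n A' X"
proof -
  have Bn: "B \<in> \<P>bar {1..n}" using subsets2_bar_trans[OF B A(1)] .
  have XL: "X \<in> \<L> (\<Gamma> B)" using X H_space_subset[OF Bn] by auto
  have fin: "finite A" using A(1) by (rule finite_of_subsets2_bar)
  have "pushforward A A' (synthesis n A X) =
      (\<Sum>\<pi>\<in>\<Gamma> B. X \<pi> *\<^sub>R pushforward A A' (synthesis_dirac A \<pi>))"
    by (simp add: synthesis_eq[OF Bn XL] linear_sum[OF linear_pushforward]
        linear_scale[OF linear_pushforward])
  also have "\<dots> = synthesis n A' X"
  proof (cases "B \<subseteq> A'")
    case True
    then show ?thesis
      by (simp add: synthesis_eq[OF Bn XL] pushforward_synthesis_dirac_subset[OF fin A(2)])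
  next
    case False
    then show ?thesis
      using pushforward_synthesis_eq_0[OF fin Bn subsets2_bar_subset[OF B] False X]
        synthesis_eq_0[OF Bn XL False] by simp
  qed
  finally show ?thesis .
qed

section \<open>The wavelet decomposition\<close>

lemma HH_E:
  assumes "F \<in> HH n T"
  obtains X where "\<And>B. B \<in> T \<Longrightarrow> X B \<in> H_space n B" "F = (\<Sum>B\<in>T. X B)"
  using assms by (auto simp: HH_def)

lemma HH_I: "(\<And>B. B \<in> T \<Longrightarrow> X B \<in> H_space n B) \<Longrightarrow> (\<Sum>B\<in>T. X B) \<in> HH n T"
  by (auto simp: HH_def)

lemma subspace_HH:
  assumes T: "T \<subseteq> \<P>bar {1..n}"
  shows "subspace (HH n T)"
proof (rule subspaceI)
  have sub: "subspace (H_space n B)" if "B \<in> T" for B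
    using that T subspace_H_space by blast
  show "0 \<in> HH n T"
    using HH_I[of T "\<lambda>_. 0" n] subspace_0[OF sub] by simp
  fix F c assume "F \<in> HH n T"
  then obtain X where X: "\<And>B. B \<in> T \<Longrightarrow> X B \<in> H_space n B" "F = (\<Sum>B\<in>T. X B)"
    by (rule HH_E) blast
  show "c *\<^sub>R F \<in> HH n T"
    unfolding X(2) scaleR_sum_right by (intro HH_I subspace_scale sub X(1))
  fix G assume "G \<in> HH n T"
  then obtain Y where Y: "\<And>B. B \<in> T \<Longrightarrow> Y B \<in> H_space n B" "G = (\<Sum>B\<in>T. Y B)"
    by (rule HH_E) blast
  show "F + G \<in> HH n T"
    unfolding X(2) Y(2) sum.distrib[symmetric] by (intro HH_I subspace_add sub X(1) Y(1))
qed

lemma HH_mono: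
  assumes "T \<subseteq> U" "U \<subseteq> \<P>bar {1..n}"
  shows "HH n T \<subseteq> HH n U"
proof
  fix F assume "F \<in> HH n T"
  then obtain X where X: "\<And>B. B \<in> T \<Longrightarrow> X B \<in> H_space n B" "F = (\<Sum>B\<in>T. X B)"
    by (rule HH_E) blast
  have fin: "finite U" using assms(2) by (rule finite_subset) simp
  have "F = (\<Sum>B\<in>U. if B \<in> T then X B else 0)"
    unfolding X(2) using assms(1) fin by (intro sum.mono_neutral_cong_left) auto
  also have "\<dots> \<in> HH n U"
    using X(1) subspace_0[OF subspace_H_space] assms by (intro HH_I) auto
  finally show "F \<in> HH n U" .
qed

lemma HH_singleton: "HH n {B} = H_space n B"
  by (auto simp: HH_def intro!: exI[of _ "\<lambda>_. _"])

lemma HH_subset_fun_space: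
  assumes "T \<subseteq> \<P>bar {1..n}"
  shows "HH n T \<subseteq> \<L> (\<Union>B\<in>T. \<Gamma> B)"
proof
  fix F assume "F \<in> HH n T"
  then obtain X where X: "\<And>B. B \<in> T \<Longrightarrow> X B \<in> H_space n B" "F = (\<Sum>B\<in>T. X B)"
    by (rule HH_E) blast
  have "X B \<in> \<L> (\<Union>B\<in>T. \<Gamma> B)" if "B \<in> T" for B
    using X(1)[OF that] H_space_subset[of B n] fun_space_mono[of "\<Gamma> B" "\<Union>B\<in>T. \<Gamma> B"] that assms
    by blast
  then show "F \<in> \<L> (\<Union>B\<in>T. \<Gamma> B)"
    unfolding X(2) by (intro subspace_sum subspace_fun_space)
qed

lemma pushforward_synthesis_sum:
  assumes A: "A \<in> \<P>bar {1..n}" and A': "A' \<in> \<P>bar A"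
    and X: "\<And>B. B \<in> \<P>bar A \<Longrightarrow> X B \<in> H_space n B"
  shows "pushforward A A' (\<Sum>B\<in>\<P>bar A. synthesis n A (X B)) = (\<Sum>B\<in>\<P>bar A'. synthesis n A' (X B))"
proof -
  have sub: "A' \<subseteq> A" using A' by (rule subsets2_bar_subset)
  have "pushforward A A' (\<Sum>B\<in>\<P>bar A. synthesis n A (X B)) = (\<Sum>B\<in>\<P>bar A. synthesis n A' (X B))"
    unfolding linear_sum[OF linear_pushforward]
    using pushforward_synthesis[OF A sub] X by (intro sum.cong) auto
  also have "\<dots> = (\<Sum>B\<in>\<P>bar A'. synthesis n A' (X B))"
  proof (rule sum.mono_neutral_right)
    show "finite (\<P>bar A)" using A finite_of_subsets2_bar by simp
    show "\<P>bar A' \<subseteq> \<P>bar A" using sub by (rule subsets2_bar_mono)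
    show "\<forall>B\<in>\<P>bar A - \<P>bar A'. synthesis n A' (X B) = 0"
    proof
      fix B assume B: "B \<in> \<P>bar A - \<P>bar A'"
      then have "B \<in> \<P>bar {1..n}" "\<not> B \<subseteq> A'"
        using A subsets2_bar_trans in_subsets2_bar_iff by blast+
      then show "synthesis n A' (X B) = 0"
        using synthesis_eq_0 H_space_subset X B by blast
    qed
  qed
  finally show ?thesis .
qed

text \<open>Once the components at the proper subsets of \<open>B\<close> are known to vanish, the marginal at \<open>B\<close> only sees the component
at \<open>B\<close> itself, and shows it unchanged by \<open>synthesis_self\<close>.\<close>

lemma synthesis_sum_eq_0:
  assumes A: "A \<in> \<P>bar {1..n}" and X: "\<And>B. B \<in> \<P>bar A \<Longrightarrow> X B \<in> H_space n B"
    and zero: "(\<Sum>B\<in>\<P>bar A. synthesis n A (X B)) = 0"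
    and B: "B \<in> \<P>bar A"
  shows "X B = 0"
proof -
  have "finite B" using B A subsets2_bar_trans finite_of_subsets2_bar by blast
  then show ?thesis using B
  proof (induction B rule: finite_psubset_induct)
    case (psubset B)
    have Bn: "B \<in> \<P>bar {1..n}" using subsets2_bar_trans[OF psubset.prems A] .
    have smaller: "X C = 0" if "C \<in> \<P>bar B - {B}" for C
    proof -
      have "C \<subset> B" using that subsets2_bar_subset by blast
      moreover have "C \<in> \<P>bar A" using that psubset.prems subsets2_bar_trans by blast
      ultimately show ?thesis by (rule psubset.IH)
    qed
    have "0 = pushforward A B (\<Sum>B\<in>\<P>bar A. synthesis n A (X B))"
      unfolding zero linear_0[OF linear_pushforward] ..
    also have "\<dots> = (\<Sum>C\<in>\<P>bar B. synthesis n B (X C))"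
      using pushforward_synthesis_sum[where X = X, OF A psubset.prems X] .
    also have "\<dots> = synthesis n B (X B)"
      using psubset.hyps smaller self_in_subsets2_bar[OF Bn]
      by (simp add: sum.remove[of _ B] linear_0[OF linear_synthesis])
    also have "\<dots> = X B"
      using synthesis_self[OF Bn] X[OF psubset.prems] H_space_subset[OF Bn] by blast
    finally show ?case by simp
  qed
qed

lemma inj_on_synthesis:
  assumes A: "A \<in> \<P>bar {1..n}"
  shows "inj_on (synthesis n A) (HH n (\<P>bar A))"
proof -
  have sub: "\<P>bar A \<subseteq> \<P>bar {1..n}" using A subsets2_bar_trans by blast
  have "F = 0" if F: "F \<in> HH n (\<P>bar A)" "synthesis n A F = 0" for F
  proof -
    from F(1) obtain X where X: "\<And>B. B \<in> \<P>bar A \<Longrightarrow> X B \<in> H_space n B" "F = (\<Sum>B\<in>\<P>bar A. X B)"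
      by (rule HH_E) blast
    have "(\<Sum>B\<in>\<P>bar A. synthesis n A (X B)) = 0"
      using F(2) by (simp add: X(2) linear_sum[OF linear_synthesis])
    from synthesis_sum_eq_0[where X = X, OF A X(1) this] show ?thesis
      by (simp add: X(2))
  qed
  then show ?thesis
    by (simp add: linear_inj_on_iff_eq_0[OF linear_synthesis subspace_HH[OF sub]])
qed

text \<open>Surjectivity by successive approximation. Suppose that the marginals of \<open>F - G\<close> at all sets of fewer than \<open>k\<close>
elements vanish. Then the marginal of \<open>F - G\<close> at a set of \<open>k\<close> elements has no proper marginals, that is, it lies in
\<open>H_space\<close>. Synthesising these marginals and adding them to \<open>G\<close> corrects all marginals at sets of \<open>k\<close> elements
without disturbing the smaller ones. After the step \<open>k = card A\<close> the marginal at \<open>A\<close> itself is exact, and it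
determines the function.\<close>

lemma synthesis_image_HH:
  assumes A: "A \<in> \<P>bar {1..n}"
  shows "synthesis n A ` HH n (\<P>bar A) = \<L> (\<Gamma> A)" (is "?V = _")
proof
  show "?V \<subseteq> \<L> (\<Gamma> A)" using synthesis_in_fun_space by blast
next
  have sub: "\<P>bar A \<subseteq> \<P>bar {1..n}" using A subsets2_bar_trans by blast
  have finA: "finite A" using A by (rule finite_of_subsets2_bar)
  have V: "subspace ?V"
    by (intro linear_subspace_image linear_synthesis subspace_HH sub)
  have HV: "synthesis n A X \<in> ?V" if "B \<in> \<P>bar A" "X \<in> H_space n B" for B X
    using that HH_mono[of "{B}" "\<P>bar A" n] sub by (auto simp: HH_singleton)
  show "\<L> (\<Gamma> A) \<subseteq> ?V"
  proof
    fix F assume F: "F \<in> \<L> (\<Gamma> A)"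
    have "\<exists>G\<in>?V. \<forall>C\<in>\<P>bar A. card C < k \<longrightarrow> pushforward A C (F - G) = 0" for k
    proof (induction k)
      case 0
      then show ?case using subspace_0[OF V] by blast
    next
      case (Suc k)
      then obtain G where G: "G \<in> ?V"
        "\<And>C. C \<in> \<P>bar A \<Longrightarrow> card C < k \<Longrightarrow> pushforward A C (F - G) = 0" by blast
      define T where "T = {C \<in> \<P>bar A. card C = k}"
      define X where "X C = pushforward A C (F - G)" for C
      define D where "D = (\<Sum>C\<in>T. synthesis n A (X C))"
      have X: "X C \<in> H_space n C" if C: "C \<in> T" for C
      proof -
        have CA: "C \<in> \<P>bar A" "C \<in> \<P>bar {1..n}" "finite C" "C \<subseteq> A"
          using C sub finite_of_subsets2_bar subsets2_bar_subset by (auto simp: T_def)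
        have "pushforward C C' (X C) = 0" if C': "C' \<in> \<P>bar C - {C}" for C'
        proof -
          have "C' \<subset> C" "C' \<in> \<P>bar A"
            using C' CA subsets2_bar_subset subsets2_bar_trans by blast+
          then have "card C' < k" using psubset_card_mono[OF CA(3)] C by (auto simp: T_def)
          then show ?thesis
            unfolding X_def using pushforward_pushforward[of C' C A] \<open>C' \<subset> C\<close> CA G(2) \<open>C' \<in> \<P>bar A\<close>
            by simp
        qed
        moreover have "X C \<in> \<L> (\<Gamma> C)"
          unfolding X_def using CA(4) by (rule pushforward_in_fun_space)
        ultimately show ?thesis using H_space_eq[OF CA(2)] by blast
      qed
      have "G + D \<in> ?V"
        unfolding D_def using G(1) HV X
        by (intro subspace_add[OF V] subspace_sum[OF V]) (auto simp: T_def)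
      moreover have "pushforward A C (F - (G + D)) = 0" if C: "C \<in> \<P>bar A" "card C < Suc k" for C
      proof -
        have CA: "C \<in> \<P>bar {1..n}" "finite C" "C \<subseteq> A"
          using C sub finite_of_subsets2_bar subsets2_bar_subset by auto
        have "pushforward A C D = (\<Sum>C'\<in>T. synthesis n C (X C'))"
          unfolding D_def linear_sum[OF linear_pushforward]
          by (intro sum.cong refl pushforward_synthesis[OF A CA(3) _ X]) (auto simp: T_def)
        \<comment> \<open>a set \<open>C' \<noteq> C\<close> of \<open>k\<close> elements is not contained in \<open>C\<close>, as \<open>C\<close> has at most \<open>k\<close> elements\<close>
        also have "\<dots> = (\<Sum>C'\<in>T. if C' = C then X C else 0)"
        proof (rule sum.cong[OF refl])
          fix C' assume C': "C' \<in> T"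
          then have C'n: "C' \<in> \<P>bar {1..n}" using sub by (auto simp: T_def)
          have XC': "X C' \<in> \<L> (\<Gamma> C')" using X[OF C'] H_space_subset[OF C'n] by blast
          show "synthesis n C (X C') = (if C' = C then X C else 0)"
          proof (cases "C' = C")
            case True
            then show ?thesis using synthesis_self[OF C'n XC'] by simp
          next
            case False
            then have "\<not> C' \<subseteq> C"
              using C' C(2) card_seteq[OF CA(2), of C'] by (auto simp: T_def)
            then show ?thesis using False synthesis_eq_0[OF C'n XC'] by simp
          qed
        qed
        also have "\<dots> = (if C \<in> T then X C else 0)"
          using finA by (simp add: T_def)
        also have "\<dots> = pushforward A C (F - G)"
          using C G(2)[of C] by (auto simp: T_def X_def less_Suc_eq)
        finally show ?thesis
          by (simp add: linear_diff[OF linear_pushforward] linear_add[OF linear_pushforward])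
      qed
      ultimately show ?case by blast
    qed
    from this[of "Suc (card A)"] obtain G where G: "G \<in> ?V" "pushforward A A (F - G) = 0"
      using self_in_subsets2_bar[OF A] by auto
    have "F - G \<in> \<L> (\<Gamma> A)"
      using F G(1) synthesis_in_fun_space by (auto intro: subspace_diff[OF subspace_fun_space])
    then have "F - G = 0" using G(2) by (simp add: pushforward_self)
    then show "F \<in> ?V" using G(1) by simp
  qed
qed

lemma wavelet_family_unique:
  assumes A: "A \<in> \<P>bar {1..n}"
    and X: "\<And>B. B \<in> \<P>bar A \<Longrightarrow> X B \<in> H_space n B" "\<And>B. B \<notin> \<P>bar A \<Longrightarrow> X B = 0"
  shows "wavelet_family n A (\<Sum>B\<in>\<P>bar A. synthesis n A (X B)) = X"
  unfolding wavelet_family_def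
proof (rule the_equality)
  fix Y assume Y: "(\<forall>B\<in>\<P>bar A. Y B \<in> H_space n B) \<and> (\<forall>B. B \<notin> \<P>bar A \<longrightarrow> Y B = 0) \<and>
    (\<Sum>B\<in>\<P>bar A. synthesis n A (X B)) = (\<Sum>B\<in>\<P>bar A. synthesis n A (Y B))"
  have "X B - Y B = 0" if B: "B \<in> \<P>bar A" for B
  proof (rule synthesis_sum_eq_0[OF A _ _ B])
    show "X B - Y B \<in> H_space n B" if "B \<in> \<P>bar A" for B
      using X(1)[OF that] Y that subspace_diff[OF subspace_H_space[OF subsets2_bar_trans[OF that A]]]
      by blast
    show "(\<Sum>B\<in>\<P>bar A. synthesis n A (X B - Y B)) = 0"
      using Y by (simp add: linear_diff[OF linear_synthesis] sum_subtractf)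
  qed
  then show "Y = X"
    using X(2) Y by (metis eq_iff_diff_eq_0 ext)
qed (use X in blast)

lemma wavelet_family:
  assumes A: "A \<in> \<P>bar {1..n}" and F: "F \<in> \<L> (\<Gamma> A)"
  shows "B \<in> \<P>bar A \<Longrightarrow> wavelet_family n A F B \<in> H_space n B"
    and "F = (\<Sum>B\<in>\<P>bar A. synthesis n A (wavelet_family n A F B))"
proof -
  from F obtain G where G: "G \<in> HH n (\<P>bar A)" "F = synthesis n A G"
    using synthesis_image_HH[OF A] by blast
  from G(1) obtain X where X: "\<And>B. B \<in> \<P>bar A \<Longrightarrow> X B \<in> H_space n B" "G = (\<Sum>B\<in>\<P>bar A. X B)"
    by (rule HH_E) blast
  define Y where "Y B = (if B \<in> \<P>bar A then X B else 0)" for B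
  have Y: "\<And>B. B \<in> \<P>bar A \<Longrightarrow> Y B \<in> H_space n B" "\<And>B. B \<notin> \<P>bar A \<Longrightarrow> Y B = 0"
    using X(1) by (auto simp: Y_def)
  have FY: "F = (\<Sum>B\<in>\<P>bar A. synthesis n A (Y B))"
    by (simp add: G(2) X(2) linear_sum[OF linear_synthesis] Y_def)
  have "wavelet_family n A F = Y"
    unfolding FY using A Y by (rule wavelet_family_unique)
  then show "B \<in> \<P>bar A \<Longrightarrow> wavelet_family n A F B \<in> H_space n B"
    and "F = (\<Sum>B\<in>\<P>bar A. synthesis n A (wavelet_family n A F B))"
    using Y FY by auto
qed

text \<open>A function on \<open>\<Gamma> A\<close> restricts to zero on the other \<open>\<Gamma> A'\<close>, and the zero function has zero components.\<close>

lemma wavelet_eq_wavelet_family: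
  assumes A: "A \<in> \<P>bar {1..n}" and F: "F \<in> \<L> (\<Gamma> A)"
  shows "wavelet n B F = wavelet_family n A F B"
proof -
  have 0: "wavelet_family n A' 0 B = 0" if A': "A' \<in> \<P>bar {1..n}" for A'
  proof -
    have "wavelet_family n A' (\<Sum>B\<in>\<P>bar A'. synthesis n A' 0) = (\<lambda>_. 0)"
      by (intro wavelet_family_unique[OF A'] subspace_0[OF subspace_H_space]
          subsets2_bar_trans[OF _ A']) auto
    then show ?thesis
      by (simp only: linear_0[OF linear_synthesis] sum.neutral_const)
  qed
  have restr: "restrict_zero (\<Gamma> A') F = (if A' = A then F else 0)" for A'
    using F by (auto simp: restrict_zero_def fun_space_def fun_eq_iff words_with_content_def)
  have "wavelet n B F = (\<Sum>A'\<in>\<P>bar {1..n}. if A' = A then wavelet_family n A F B else 0)"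
    unfolding wavelet_def by (intro sum.cong) (auto simp: restr 0)
  then show ?thesis using A by simp
qed

section \<open>Dimensions\<close>

text \<open>The space of all functions on words is infinite-dimensional, so dimensions are compared through bases.\<close>

lemma dim_linear_image_eq:
  fixes f :: "'a::real_vector \<Rightarrow> 'b::real_vector"
  assumes f: "linear f" and V: "subspace V" and inj: "inj_on f V"
  shows "dim (f ` V) = dim V"
proof -
  obtain B where B: "B \<subseteq> V" "independent B" "V \<subseteq> span B" "card B = dim V"
    using basis_exists by blast
  have span: "span B = V" using B V by (metis span_minimal subset_antisym)
  have "independent (f ` B)"
    using linear_independent_injective_image[OF f B(2)] inj by (simp add: span)
  moreover have "span (f ` B) = f ` V"
    by (simp add: linear_span_image[OF f] span)
  ultimately have "dim (f ` V) = card (f ` B)"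
    by (metis dim_span_eq_card_independent)
  also have "\<dots> = dim V"
    using inj_on_subset[OF inj B(1)] B(4) by (simp add: card_image)
  finally show ?thesis .
qed

text \<open>The elements of a basis of \<open>W\<close> are added one at a time to a basis of \<open>U\<close>. The finite set \<open>S\<close> only serves to make
these bases finite.\<close>

lemma dim_direct_sum:
  fixes U W :: "'a::real_vector set"
  assumes U: "subspace U" and W: "subspace W" and int: "U \<inter> W \<subseteq> {0}"
    and fin: "finite S" "U \<subseteq> span S" "W \<subseteq> span S"
  shows "dim {x + y | x y. x \<in> U \<and> y \<in> W} = dim U + dim W"
proof -
  obtain B where B: "B \<subseteq> U" "independent B" "U \<subseteq> span B" "card B = dim U"
    using basis_exists by blast
  obtain C where C: "C \<subseteq> W" "independent C" "W \<subseteq> span C" "card C = dim W"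
    using basis_exists by blast
  have span: "span B = U" "span C = W"
    using B C U W by (metis span_minimal subset_antisym)+
  have finite: "finite B" "finite C"
    using independent_span_bound[OF fin(1) B(2)] independent_span_bound[OF fin(1) C(2)]
      order_trans[OF B(1) fin(2)] order_trans[OF C(1) fin(3)] by simp_all
  have indep: "independent (B \<union> D)" if "D \<subseteq> C" for D
    using finite_subset[OF that finite(2)] that
  proof (induction D rule: finite_induct)
    case empty
    then show ?case using B by simp
  next
    case (insert c D)
    have "c \<notin> span (B \<union> D)"
    proof
      assume "c \<in> span (B \<union> D)"
      then obtain x y where xy: "c = x + y" "x \<in> span B" "y \<in> span D"
        unfolding span_Un by blast
      \<comment> \<open>\<open>x = c - y\<close> lies in both summands\<close>
      have "c - y \<in> W"
        using insert.prems C(1) xy(3) span_mono[of D C] span W by (blast intro: subspace_diff)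
      then have "x = 0" using xy int span by auto
      then have "c \<in> span D" using xy by simp
      moreover have "independent (insert c D)"
        using independent_mono[OF C(2) insert.prems] .
      ultimately show False
        using insert.hyps independent_insert[of c D] by simp
    qed
    then show ?case using insert by (simp add: independent_insertI)
  qed
  have "B \<inter> C = {}"
  proof -
    have "B \<inter> C \<subseteq> {0}" using int B(1) C(1) by blast
    moreover have "0 \<notin> B" using B(2) dependent_zero by blast
    ultimately show ?thesis by blast
  qed
  then have "card (B \<union> C) = dim U + dim W"
    using finite B(4) C(4) by (simp add: card_Un_disjoint)
  moreover have "{x + y | x y. x \<in> U \<and> y \<in> W} = span (B \<union> C)"
    unfolding span_Un span ..
  ultimately show ?thesis
    using dim_span_eq_card_independent[OF indep[OF subset_refl]] by simp
qed

lemma fun_space_eq_span: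
  assumes "finite S"
  shows "\<L> S = span ((\<lambda>\<sigma>. indicator {\<sigma>}) ` S)"
proof
  show "span ((\<lambda>\<sigma>. indicator {\<sigma>}) ` S) \<subseteq> \<L> S"
    by (intro span_minimal subspace_fun_space) (auto simp: fun_space_def indicator_def)
  show "\<L> S \<subseteq> span ((\<lambda>\<sigma>. indicator {\<sigma>}) ` S)"
  proof
    fix F assume F: "F \<in> \<L> S"
    have "F = (\<Sum>\<sigma>\<in>S. F \<sigma> *\<^sub>R indicator {\<sigma>})"
    proof (rule ext)
      fix \<pi>
      have "(\<Sum>\<sigma>\<in>S. F \<sigma> *\<^sub>R indicator {\<sigma>}) \<pi> = (\<Sum>\<sigma>\<in>S. if \<sigma> = \<pi> then F \<sigma> else 0)"
        unfolding sum_fun_apply by (intro sum.cong) (auto simp: indicator_def)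
      then show "F \<pi> = (\<Sum>\<sigma>\<in>S. F \<sigma> *\<^sub>R indicator {\<sigma>}) \<pi>"
        using F assms by (simp add: fun_space_def)
    qed
    also have "\<dots> \<in> span ((\<lambda>\<sigma>. indicator {\<sigma>}) ` S)"
      by (intro span_sum span_scale span_base) auto
    finally show "F \<in> span ((\<lambda>\<sigma>. indicator {\<sigma>}) ` S)" .
  qed
qed

lemma dim_fun_space:
  assumes "finite S"
  shows "dim (\<L> S) = card S"
proof -
  let ?\<delta> = "\<lambda>\<sigma>. indicator {\<sigma>} :: word \<Rightarrow> real"
  have inj: "inj ?\<delta>"
    by (rule injI) (metis indicator_eq_1_iff singletonD singletonI zero_neq_one indicator_simps(1))
  have "independent (?\<delta> ` S)"
  proof (rule ccontr)
    assume "\<not> independent (?\<delta> ` S)"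
    then obtain u v where u: "v \<in> ?\<delta> ` S" "u v \<noteq> 0" "(\<Sum>w\<in>?\<delta> ` S. u w *\<^sub>R w) = 0"
      using dependent_finite[of "?\<delta> ` S"] assms by auto
    then obtain \<tau> where \<tau>: "\<tau> \<in> S" "v = ?\<delta> \<tau>" by auto
    have "0 = (\<Sum>w\<in>?\<delta> ` S. u w *\<^sub>R w) \<tau>" by (simp add: u(3))
    also have "\<dots> = (\<Sum>\<sigma>\<in>S. u (?\<delta> \<sigma>) * ?\<delta> \<sigma> \<tau>)"
      by (simp add: sum_fun_apply sum.reindex[OF inj_on_subset[OF inj]])
    also have "\<dots> = u (?\<delta> \<tau>)"
      using assms \<tau> by (simp add: indicator_def)
    finally show False using u \<tau> by simp
  qed
  then have "dim (\<L> S) = card (?\<delta> ` S)"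
    unfolding fun_space_eq_span[OF assms] by (rule dim_span_eq_card_independent)
  also have "\<dots> = card S"
    using inj_on_subset[OF inj] by (simp add: card_image)
  finally show ?thesis .
qed

lemma dim_HH:
  assumes "T \<subseteq> \<P>bar {1..n}"
  shows "dim (HH n T) = (\<Sum>B\<in>T. dim (H_space n B))"
proof -
  have "finite T" using assms by (rule finite_subset) simp
  then show ?thesis using assms
  proof (induction T rule: finite_induct)
    case empty
    have "HH n {} = span {}" by (auto simp: HH_def)
    then show ?case using dim_span_eq_card_independent[OF independent_empty] by simp
  next
    case (insert B T)
    have B: "B \<in> \<P>bar {1..n}" and T: "T \<subseteq> \<P>bar {1..n}" using insert.prems by auto
    let ?U = "\<Union>C\<in>insert B T. \<Gamma> C"
    have fin: "finite ?U" using insert.hyps by auto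
    have "HH n (insert B T) = {x + y | x y. x \<in> H_space n B \<and> y \<in> HH n T}"
    proof (intro equalityI subsetI)
      fix F assume "F \<in> HH n (insert B T)"
      then obtain X where X: "\<And>C. C \<in> insert B T \<Longrightarrow> X C \<in> H_space n C" "F = (\<Sum>C\<in>insert B T. X C)"
        by (rule HH_E) blast
      then show "F \<in> {x + y | x y. x \<in> H_space n B \<and> y \<in> HH n T}"
        using insert.hyps HH_I[of T X n] by auto
    next
      fix F assume "F \<in> {x + y | x y. x \<in> H_space n B \<and> y \<in> HH n T}"
      then show "F \<in> HH n (insert B T)"
        using HH_mono[OF _ insert.prems, of T] HH_mono[OF _ insert.prems, of "{B}"]
          subspace_add[OF subspace_HH[OF insert.prems]]
        by (auto simp: HH_singleton)
    qed
    moreover have "dim {x + y | x y. x \<in> H_space n B \<and> y \<in> HH n T} = dim (H_space n B) + dim (HH n T)"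
    proof (rule dim_direct_sum[OF subspace_H_space[OF B] subspace_HH[OF T]])
      have "\<Gamma> B \<inter> (\<Union>C\<in>T. \<Gamma> C) = {}"
        using insert.hyps by (auto simp: words_with_content_def)
      then show "H_space n B \<inter> HH n T \<subseteq> {0}"
        using H_space_subset[OF B] HH_subset_fun_space[OF T]
        by (fastforce simp: fun_space_def fun_eq_iff)
      show "finite ((\<lambda>\<sigma>. indicator {\<sigma>} :: word \<Rightarrow> real) ` ?U)" using fin by simp
      show "H_space n B \<subseteq> span ((\<lambda>\<sigma>. indicator {\<sigma>}) ` ?U)"
        unfolding fun_space_eq_span[OF fin, symmetric]
        using H_space_subset[OF B] fun_space_mono[of "\<Gamma> B" ?U] by auto
      show "HH n T \<subseteq> span ((\<lambda>\<sigma>. indicator {\<sigma>}) ` ?U)"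
        unfolding fun_space_eq_span[OF fin, symmetric]
        using HH_subset_fun_space[OF T] fun_space_mono[of "\<Union>C\<in>T. \<Gamma> C" ?U] by auto
    qed
    ultimately show ?case using insert T by simp
  qed
qed

lemma sum_dim_H_space:
  assumes A: "A \<in> \<P>bar {1..n}"
  shows "(\<Sum>B\<in>\<P>bar A. dim (H_space n B)) = fact (card A)"
proof -
  have sub: "\<P>bar A \<subseteq> \<P>bar {1..n}" using A subsets2_bar_trans by blast
  have "(\<Sum>B\<in>\<P>bar A. dim (H_space n B)) = dim (synthesis n A ` HH n (\<P>bar A))"
    using dim_linear_image_eq[OF linear_synthesis subspace_HH[OF sub] inj_on_synthesis[OF A]]
    by (simp add: dim_HH[OF sub])
  also have "\<dots> = fact (card A)"
    by (simp add: synthesis_image_HH[OF A] dim_fun_space card_words_with_content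
        finite_of_subsets2_bar[OF A])
  finally show ?thesis .
qed

text \<open>The numbers \<open>dim (H_space n B)\<close> and the derangement numbers have the same sums over \<open>\<P>bar A\<close> for every \<open>A\<close>, and such sums
determine their terms.\<close>

lemma dim_H_space:
  assumes "B \<in> \<P>bar {1..n}"
  shows "dim (H_space n B) = derangement_number (card B)"
  using finite_of_subsets2_bar[OF assms] assms
proof (induction B rule: finite_psubset_induct)
  case (psubset B)
  have IH: "dim (H_space n C) = derangement_number (card C)" if "C \<in> \<P>bar B - {B}" for C
  proof -
    have "C \<subset> B" using that subsets2_bar_subset by blast
    moreover have "C \<in> \<P>bar {1..n}" using that psubset.prems subsets2_bar_trans by blast
    ultimately show ?thesis by (rule psubset.IH)
  qed
  have "(\<Sum>C\<in>\<P>bar B. dim (H_space n C)) = (\<Sum>C\<in>\<P>bar B. derangement_number (card C))"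
    using sum_dim_H_space[OF psubset.prems] sum_derangement_number[OF psubset.hyps] by simp
  moreover have "(\<Sum>C\<in>\<P>bar B - {B}. dim (H_space n C)) =
      (\<Sum>C\<in>\<P>bar B - {B}. derangement_number (card C))"
    using IH by (rule sum.cong[OF refl])
  ultimately show ?case
    using psubset.hyps self_in_subsets2_bar[OF psubset.prems]
    by (simp add: sum.remove[of "\<P>bar B" B])
qed

section \<open>Functions with prescribed marginals\<close>

text \<open>By \<open>pushforward_synthesis_sum\<close> the marginal at \<open>A'\<close> is synthesised on \<open>A'\<close> from the components at the subsets
of \<open>A'\<close>, and on \<open>A'\<close> this synthesis is injective.\<close>

lemma marginal_eq_iff_wavelet_family_eq:
  assumes A: "A \<in> \<P>bar {1..n}" and A': "A' \<in> \<P>bar A"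
    and F: "F \<in> \<L> (\<Gamma> A)" and G: "G \<in> \<L> (\<Gamma> A)"
  shows "marginal n A' F = marginal n A' G \<longleftrightarrow>
    (\<forall>B\<in>\<P>bar A'. wavelet_family n A F B = wavelet_family n A G B)"
proof -
  have A'n: "A' \<in> \<P>bar {1..n}" using A' A by (rule subsets2_bar_trans)
  let ?D = "\<lambda>B. wavelet_family n A F B - wavelet_family n A G B"
  have *: "marginal n A' H = (\<Sum>B\<in>\<P>bar A'. synthesis n A' (wavelet_family n A H B))"
    if H: "H \<in> \<L> (\<Gamma> A)" for H
  proof -
    have "marginal n A' H
        = pushforward A A' (\<Sum>B\<in>\<P>bar A. synthesis n A (wavelet_family n A H B))"
      unfolding wavelet_family(2)[OF A H, symmetric] by (rule marginal_eq_pushforward[OF A A' H])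
    also have "\<dots> = (\<Sum>B\<in>\<P>bar A'. synthesis n A' (wavelet_family n A H B))"
      by (rule pushforward_synthesis_sum[OF A A' wavelet_family(1)[OF A H]])
    finally show ?thesis .
  qed
  have D: "?D B \<in> H_space n B" if "B \<in> \<P>bar A'" for B
  proof -
    have B: "B \<in> \<P>bar A" using that A' by (rule subsets2_bar_trans)
    show ?thesis
      using wavelet_family(1)[OF A F B] wavelet_family(1)[OF A G B]
        subspace_diff[OF subspace_H_space[OF subsets2_bar_trans[OF B A]]] by simp
  qed
  have "marginal n A' F = marginal n A' G \<longleftrightarrow> (\<Sum>B\<in>\<P>bar A'. synthesis n A' (?D B)) = 0"
    by (simp add: *[OF F] *[OF G] linear_diff[OF linear_synthesis] sum_subtractf)
  also have "\<dots> \<longleftrightarrow> (\<forall>B\<in>\<P>bar A'. ?D B = 0)"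
    using synthesis_sum_eq_0[where X = ?D, OF A'n D] linear_0[OF linear_synthesis[of n A']]
    by (auto intro: sum.neutral)
  finally show ?thesis by simp
qed

lemma marginal_solutions:
  assumes A: "A \<in> \<P>bar {1..n}" and F0: "F0 \<in> \<L> (\<Gamma> A)" and S: "\<S> \<subseteq> \<P>bar A"
  shows "{F \<in> \<L> (\<Gamma> A). \<forall>A'\<in>\<S>. marginal n A' F = marginal n A' F0}
    = {synthesis n A (\<Sum>B\<in>\<P>bar\<Union> \<S>. wavelet n B F0) + synthesis n A X | X.
         X \<in> HH n (\<P>bar A - \<P>bar\<Union> \<S>)}" (is "?Sol = ?Par")
proof -
  define T where "T = \<P>bar\<Union> \<S>"
  define \<psi> where "\<psi> = wavelet_family n A"
  have T: "T \<subseteq> \<P>bar A"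
    using S subsets2_bar_trans by (auto simp: T_def subsets2_bar_Union_def)
  have fin: "finite (\<P>bar A)" using finite_of_subsets2_bar[OF A] by simp
  have \<psi>: "\<psi> F B \<in> H_space n B" if "F \<in> \<L> (\<Gamma> A)" "B \<in> \<P>bar A" for F B
    unfolding \<psi>_def using wavelet_family(1)[OF A that] .
  have wavelet: "wavelet n B F0 = \<psi> F0 B" for B
    unfolding \<psi>_def by (rule wavelet_eq_wavelet_family[OF A F0])
  have "(\<forall>A'\<in>\<S>. marginal n A' F = marginal n A' F0) \<longleftrightarrow> (\<forall>B\<in>T. \<psi> F B = \<psi> F0 B)"
    if F: "F \<in> \<L> (\<Gamma> A)" for F
  proof -
    have "(\<forall>A'\<in>\<S>. marginal n A' F = marginal n A' F0) \<longleftrightarrow>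
        (\<forall>A'\<in>\<S>. \<forall>B\<in>\<P>bar A'. \<psi> F B = \<psi> F0 B)"
      unfolding \<psi>_def using S
      by (intro ball_cong refl marginal_eq_iff_wavelet_family_eq[OF A _ F F0]) blast
    then show ?thesis by (simp add: T_def subsets2_bar_Union_def)
  qed
  then have sol: "?Sol = {F \<in> \<L> (\<Gamma> A). \<forall>B\<in>T. \<psi> F B = \<psi> F0 B}"
    by (intro Collect_cong conj_cong refl)
  have split: "(\<Sum>B\<in>\<P>bar A. synthesis n A (W B)) =
      synthesis n A (\<Sum>B\<in>T. W B) + synthesis n A (\<Sum>B\<in>\<P>bar A - T. W B)" for W
    using sum.subset_diff[OF T fin, of "\<lambda>B. synthesis n A (W B)"]
    by (simp add: linear_sum[OF linear_synthesis] add.commute)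
  show ?thesis
    unfolding sol T_def[symmetric]
  proof (intro equalityI subsetI)
    fix F assume "F \<in> {F \<in> \<L> (\<Gamma> A). \<forall>B\<in>T. \<psi> F B = \<psi> F0 B}"
    then have F: "F \<in> \<L> (\<Gamma> A)" "\<And>B. B \<in> T \<Longrightarrow> \<psi> F B = \<psi> F0 B" by auto
    have "F = synthesis n A (\<Sum>B\<in>T. wavelet n B F0) + synthesis n A (\<Sum>B\<in>\<P>bar A - T. \<psi> F B)"
      using wavelet_family(2)[OF A F(1), folded \<psi>_def] unfolding split
      by (simp add: wavelet F(2))
    moreover have "(\<Sum>B\<in>\<P>bar A - T. \<psi> F B) \<in> HH n (\<P>bar A - T)"
      using \<psi>[OF F(1)] by (intro HH_I) auto
    ultimately show "F \<in> {synthesis n A (\<Sum>B\<in>T. wavelet n B F0) + synthesis n A X | X.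
        X \<in> HH n (\<P>bar A - T)}" by blast
  next
    fix F assume "F \<in> {synthesis n A (\<Sum>B\<in>T. wavelet n B F0) + synthesis n A X | X.
        X \<in> HH n (\<P>bar A - T)}"
    then obtain X where X: "X \<in> HH n (\<P>bar A - T)"
      "F = synthesis n A (\<Sum>B\<in>T. wavelet n B F0) + synthesis n A X" by blast
    from X(1) obtain Y where Y: "\<And>B. B \<in> \<P>bar A - T \<Longrightarrow> Y B \<in> H_space n B"
      "X = (\<Sum>B\<in>\<P>bar A - T. Y B)" by (rule HH_E) blast
    \<comment> \<open>the components of the candidate: prescribed on \<open>T\<close>, free elsewhere\<close>
    define W where "W B = (if B \<in> T then \<psi> F0 B else if B \<in> \<P>bar A then Y B else 0)" for B
    have F: "F = (\<Sum>B\<in>\<P>bar A. synthesis n A (W B))"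
      unfolding split X(2) Y(2) by (simp add: W_def wavelet)
    have "\<psi> F = W"
      unfolding F \<psi>_def
    proof (rule wavelet_family_unique[OF A])
      show "W B \<in> H_space n B" if "B \<in> \<P>bar A" for B
        using that \<psi>[OF F0] Y(1) by (simp add: W_def)
      show "W B = 0" if "B \<notin> \<P>bar A" for B
        using that T by (auto simp: W_def)
    qed
    moreover have "F \<in> \<L> (\<Gamma> A)"
      unfolding F by (intro subspace_sum subspace_fun_space synthesis_in_fun_space)
    ultimately show "F \<in> {F \<in> \<L> (\<Gamma> A). \<forall>B\<in>T. \<psi> F B = \<psi> F0 B}"
      by (simp add: W_def)
  qed
qed

lemma affine_dimension_translate:
  assumes V: "subspace V"
  shows "affine_dimension {p + v | v. v \<in> V} = dim V"
proof -
  have "{x - y | x y. x \<in> {p + v | v. v \<in> V} \<and> y \<in> {p + v | v. v \<in> V}} = V"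
  proof (intro equalityI subsetI)
    fix z assume "z \<in> V"
    then have "z = (p + z) - (p + 0)" "0 \<in> V" using V by (auto intro: subspace_0)
    then show "z \<in> {x - y | x y. x \<in> {p + v | v. v \<in> V} \<and> y \<in> {p + v | v. v \<in> V}}"
      using \<open>z \<in> V\<close> by blast
  qed (use V in \<open>auto intro: subspace_diff\<close>)
  then show ?thesis by (simp add: affine_dimension_def)
qed

lemma affine_dimension_synthesis_HH:
  assumes A: "A \<in> \<P>bar {1..n}" and T: "T \<subseteq> \<P>bar A"
  shows "affine_dimension {p + synthesis n A X | X. X \<in> HH n T} = dim (HH n T)"
proof -
  have sub: "\<P>bar A \<subseteq> \<P>bar {1..n}" using A subsets2_bar_trans by blast
  have V: "subspace (HH n T)" using T sub by (intro subspace_HH) blast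
  have "{p + synthesis n A X | X. X \<in> HH n T} = {p + v | v. v \<in> synthesis n A ` HH n T}" by blast
  then have "affine_dimension {p + synthesis n A X | X. X \<in> HH n T} = dim (synthesis n A ` HH n T)"
    by (simp only: affine_dimension_translate[OF linear_subspace_image[OF linear_synthesis V]])
  also have "\<dots> = dim (HH n T)"
    using inj_on_subset[OF inj_on_synthesis[OF A] HH_mono[OF T sub]]
    by (rule dim_linear_image_eq[OF linear_synthesis V])
  finally show ?thesis .
qed

lemma dim_HH_diff:
  assumes A: "A \<in> \<P>bar {1..n}" and T: "T \<subseteq> \<P>bar A"
  shows "int (dim (HH n (\<P>bar A - T))) = fact (card A) - (\<Sum>B\<in>T. int (derangement_number (card B)))"
proof -
  have fin: "finite A" using A by (rule finite_of_subsets2_bar)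
  have sub: "\<P>bar A - T \<subseteq> \<P>bar {1..n}" using A subsets2_bar_trans by blast
  have "dim (HH n (\<P>bar A - T)) = (\<Sum>B\<in>\<P>bar A - T. derangement_number (card B))"
    unfolding dim_HH[OF sub] using sub dim_H_space by (intro sum.cong) auto
  moreover have "(\<Sum>B\<in>\<P>bar A - T. derangement_number (card B)) +
      (\<Sum>B\<in>T. derangement_number (card B)) = fact (card A)"
    using sum.subset_diff[OF T finite_subsets2_bar[OF fin], of "\<lambda>B. derangement_number (card B)"]
    by (simp add: sum_derangement_number[OF fin])
  ultimately have "dim (HH n (\<P>bar A - T)) + (\<Sum>B\<in>T. derangement_number (card B)) = fact (card A)"
    by simp
  from arg_cong[OF this, of int] show ?thesis
    by simp
qed

text \<open>A single set \<open>A'\<close> is the family \<open>{A'}\<close>, for which the derangement numbers add up to \<open>(card A')!\<close> by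
\<open>sum_derangement_number\<close>.\<close>

theorem theorem9:
  fixes n :: nat and A :: "nat set" and F0 :: "word \<Rightarrow> real"
  assumes "n \<ge> 1"
    and "A \<in> \<P> {1..n}"
    and "F0 \<in> \<L> (\<Gamma> A)"
  shows
    "(\<forall>A'\<in>\<P> A.
        {F \<in> \<L> (\<Gamma> A). marginal n A' F = marginal n A' F0}
          = {synthesis n A (\<Sum>B\<in>\<P>bar A'. wavelet n B F0) + synthesis n A X | X.
               X \<in> HH n (\<P>bar A - \<P>bar A')}
        \<and> affine_dimension {F \<in> \<L> (\<Gamma> A). marginal n A' F = marginal n A' F0}
            = dim (HH n (\<P>bar A - \<P>bar A'))
        \<and> int (dim (HH n (\<P>bar A - \<P>bar A'))) = fact (card A) - fact (card A'))
     \<and>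
     (\<forall>\<S>\<subseteq>\<P> A.
        {F \<in> \<L> (\<Gamma> A). \<forall>A'\<in>\<S>. marginal n A' F = marginal n A' F0}
          = {synthesis n A (\<Sum>B\<in>\<P>bar\<Union> \<S>. wavelet n B F0) + synthesis n A X | X.
               X \<in> HH n (\<P>bar A - \<P>bar\<Union> \<S>)}
        \<and> affine_dimension {F \<in> \<L> (\<Gamma> A). \<forall>A'\<in>\<S>. marginal n A' F = marginal n A' F0}
            = dim (HH n (\<P>bar A - \<P>bar\<Union> \<S>))
        \<and> int (dim (HH n (\<P>bar A - \<P>bar\<Union> \<S>)))
            = fact (card A) - (\<Sum>B\<in>\<P>bar\<Union> \<S>. int (derangement_number (card B))))"
    (is "?single \<and> ?family")
proof -
  have A: "A \<in> \<P>bar {1..n}" using assms(2) by (simp add: subsets2_bar_def)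
  have family: "{F \<in> \<L> (\<Gamma> A). \<forall>A'\<in>\<S>. marginal n A' F = marginal n A' F0}
          = {synthesis n A (\<Sum>B\<in>\<P>bar\<Union> \<S>. wavelet n B F0) + synthesis n A X | X.
               X \<in> HH n (\<P>bar A - \<P>bar\<Union> \<S>)}
      \<and> affine_dimension {F \<in> \<L> (\<Gamma> A). \<forall>A'\<in>\<S>. marginal n A' F = marginal n A' F0}
          = dim (HH n (\<P>bar A - \<P>bar\<Union> \<S>))
      \<and> int (dim (HH n (\<P>bar A - \<P>bar\<Union> \<S>)))
          = fact (card A) - (\<Sum>B\<in>\<P>bar\<Union> \<S>. int (derangement_number (card B)))"
    if S: "\<S> \<subseteq> \<P> A" for \<S>
  proof -
    have S': "\<S> \<subseteq> \<P>bar A" using S by (auto simp: subsets2_bar_def)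
    then have "\<P>bar\<Union> \<S> \<subseteq> \<P>bar A"
      using subsets2_bar_trans by (auto simp: subsets2_bar_Union_def)
    then show ?thesis
      unfolding marginal_solutions[OF A assms(3) S']
      by (intro conjI refl affine_dimension_synthesis_HH[OF A] dim_HH_diff[OF A] Diff_subset)
  qed
  moreover have ?single
  proof
    fix A' assume A': "A' \<in> \<P> A"
    have "finite A'"
      using A' finite_of_subsets2_bar[OF A] by (auto simp: subsets2_def intro: finite_subset)
    from arg_cong[OF sum_derangement_number[OF this], of int]
    have sum: "(\<Sum>B\<in>\<P>bar A'. int (derangement_number (card B))) = fact (card A')"
      by simp
    have union: "\<P>bar\<Union> {A'} = \<P>bar A'"
      by (simp add: subsets2_bar_Union_def)
    have all: "(\<forall>x\<in>{A'}. P x) = P A'" for P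
      by simp
    have "{A'} \<subseteq> \<P> A" using A' by simp
    from family[OF this, unfolded union sum all] show "{F \<in> \<L> (\<Gamma> A). marginal n A' F = marginal n A' F0}
          = {synthesis n A (\<Sum>B\<in>\<P>bar A'. wavelet n B F0) + synthesis n A X | X.
               X \<in> HH n (\<P>bar A - \<P>bar A')}
        \<and> affine_dimension {F \<in> \<L> (\<Gamma> A). marginal n A' F = marginal n A' F0}
            = dim (HH n (\<P>bar A - \<P>bar A'))
        \<and> int (dim (HH n (\<P>bar A - \<P>bar A'))) = fact (card A) - fact (card A')"
      .
  qed
  ultimately show ?thesis by blast
qed

end
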